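(* Let $\mathfrak{X}=(L\xrightarrow{\partial_2}M\xrightarrow{\partial_1}N,\{-,-\})$ be a 2-crossed module of groups, let $K$ be a field, let $\mathfrak{C}^2$ be the Gray 3-(group)-groupoid with a single object (cat$^2$-group) associated to $\mathfrak{X}$, and let $\overline{\delta}=(\mathrm{K}_3\xrightarrow{\overline{\tau}_3}\mathrm{K}_2\xrightarrow{\overline{\tau}_2}\mathrm{K}_1)$ be the length-2 chain complex of $K$-vector spaces obtained from $\overline{K(\mathfrak{C}^2)}$. Then the right regular representation $$\lambda:\mathfrak{C}^2\longrightarrow \mathbf{Aut}(\overline{\delta})\leqslant\mathbf{Ch}^2_K$$ exists as a lax 3-functor, contravariant on 1-cells. Explicitly, $\lambda( * )=\overline{\delta}$, and the following assignments on generators give well-defined linear maps with the listed properties. (1) For $n\in N$, the maps $\lambda^0_n(\mathbf{e}_{1,1,n'})=\mathbf{e}_{1,1,n'n}$, $\lambda^1_n(\overline{\mathbf{v}}^{11}_{1,m',n'})=\overline{\mathbf{v}}^{11}_{1,m',n'n}$, $\lambda^2_n(\overline{\mathbf{v}}^{22}_{l',m',n'})=\overline{\mathbf{v}}^{22}_{l',m',n'n}$ form a chain automorphism $\lambda_n=(\lambda_n^2,\lambda_n^1,\lambda_n^0)$ of $\overline{\delta}$, and $\lambda_{nn'}=\lambda_{n'}\circ\lambda_n$ for all $n,n'\in N$. (2) For $(m,n)\in M\rtimes N$, the maps $\lambda'_{m,n}:\mathrm{K}_1\to\mathrm{K}_2$, $\lambda'_{m,n}(\mathbf{e}_{1,1,n'})=\overline{\mathbf{v}}^{11}_{1,{}^{n'}m,n'n}$,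 and $\lambda''_{m,n}:\mathrm{K}_2\to\mathrm{K}_3$, $\lambda''_{m,n}(\overline{\mathbf{v}}^{11}_{1,m',n'})=\overline{\mathbf{v}}^{22}_{\{m',{}^{n'}m\},\,m'\,{}^{n'}m,\,n'n}$, are the components of a 1-homotopy $\lambda_{m,n}:\lambda_n\Rightarrow\lambda_{\partial_1(m)n}$. (3) For $(l,m,n)\in L\rtimes M\rtimes N$, the map $\alpha'_{l,m,n}:\mathrm{K}_1\to\mathrm{K}_3$, $\alpha'_{l,m,n}(\mathbf{e}_{1,1,n'})=\overline{\mathbf{v}}^{22}_{{}^{n'}l,{}^{n'}m,n'n}$, is the component of a 2-homotopy $\lambda_{l,m,n}:\lambda_{m,n}\Rrightarrow\lambda_{\partial_2(l)m,n}$. (4) $\lambda$ preserves the compositions of cells: for all $l,l'\in L$, $m,m'\in M$, $n,n'\in N$, - vertical composition of 2-cells: $\lambda'_{m'm,n}=\lambda'_{m',\partial_1(m)n}+\lambda'_{m,n}$ and $\lambda''_{m'm,n}=\lambda''_{m',\partial_1(m)n}+\lambda''_{m,n}$; - horizontal compositions of 2-cells: $\lambda'_{m\,{}^nm',nn'}=\lambda'_{m',n'}\lambda^0_n+\lambda^1_{\partial_1(m')n'}\lambda'_{m,n}$, $\lambda''_{m\,{}^nm',nn'}=\lambda''_{m',n'}\lambda^1_n+\lambda^2_{\partial_1(m')n'}\lambda''_{m,n}$, and $\lambda'_{{}^{\partial_1(m)n}m'\,m,nn'}=\lambda^1_{n'}\lambda'_{m,n}+\lambda'_{m',n'}\lambda^0_{\partial_1(m)n}$,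 $\lambda''_{{}^{\partial_1(m)n}m'\,m,nn'}=\lambda^2_{n'}\lambda''_{m,n}+\lambda''_{m',n'}\lambda^1_{\partial_1(m)n}$; - 2-vertical composition of 3-cells: $\alpha'_{l'l,m,n}=\alpha'_{l',\partial_2(l)m,n}+\alpha'_{l,m,n}$; - 1-vertical composition of 3-cells: $\alpha'_{l'\,{}^{m'}l,\,m'm,\,n}=\alpha'_{l',m',\partial_1(m)n}+\alpha'_{l,m,n}$; - group multiplication of 3-cells: $\alpha'_{l\,{}^m({}^nl'),\,m\,{}^nm',\,nn'}=\lambda^2_{\partial_1(m')n'}\alpha'_{l,m,n}+\alpha'_{l',m',n'}\lambda^0_n$.
   Context: **2-crossed modules.** A 2-crossed module $\mathfrak{X}=(L\xrightarrow{\partial_2}M\xrightarrow{\partial_1}N,\{-,-\})$ is a complex of groups ($\partial_1\partial_2=1$) with (left) actions of $N$ on $M$ and $L$ such that $\partial_2,\partial_1$ are $N$-equivariant ($N$ acting on itself by conjugation), and a function $\{-,-\}:M\times M\to L$ (Peiffer lifting) satisfying, for all $l,l'\in L$, $m,m',m''\in M$, $n\in N$: (2CM1) $\partial_2\{m,m'\}=({}^{\partial_1m}m')\,m\,m'^{-1}m^{-1}$; (2CM2) $\{\partial_2l,\partial_2l'\}=[l',l]$; (2CM3) (i) $\{mm',m''\}={}^{\partial_1m}\{m',m''\}\{m,m'm''m'^{-1}\}$, (ii) $\{m,m'm''\}=\{m,m'\}\;{}^{mm'm^{-1}}\{m,m''\}$; (2CM4) $\{m,\partial_2l\}\{\partial_2l,m\}={}^{\partial_1m}l\,l^{-1}$;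 (2CM5) ${}^n\{m,m'\}=\{{}^nm,{}^nm'\}$. Here $M$ acts on $L$ by ${}^ml=\{\partial_2l,m\}\,l$. **The associated $\mathfrak{C}^2$.** It has one 0-cell $*$. The 1-cells are elements of $N$ (also written $(1,1,n)$), composed by the group law. The 2-cells are elements $(m,n)$ of $M\rtimes N$ (also written $(1,m,n)$), with $(m,n):n\Rightarrow\partial_1(m)n$ and product $(m,n)(m',n')=(m\,{}^nm',nn')$. The 3-cells are elements of $L\rtimes M\rtimes N$, with $(l,m,n):(m,n)\Rrightarrow(\partial_2(l)m,n)$ and product $(l,m,n)(l',m',n')=(l\;{}^m({}^nl'),m\,{}^nm',nn')$. Vertical composition of 2-cells: $(m',\partial_1(m)n)\#_2(m,n)=(m'm,n)$. The two horizontal compositions of $(m,n)$ and $(m',n')$ are $(m\,{}^nm',nn')$ and $({}^{\partial_1(m)n}m'\,m,nn')$. 2-vertical composition of 3-cells: $(l',\partial_2(l)m,n)\#_3(l,m,n)=(l'l,m,n)$. 1-vertical composition: $(l',m',\partial_1(m)n)\#_1(l,m,n)=(l'\,{}^{m'}l,m'm,n)$. **The algebra $\overline{K(\mathfrak{C}^2)}$.** For a group $G$, $K(G)$ is the group algebra with basis $\{\mathbf{e}_g\}_{g\in G}$. Identify $N$ with $1\rtimes1\rtimes N$ and $M\rtimes N$ with $1\rtimes M\rtimes N\subseteq L\rtimes M\rtimes N$. Let $\sigma_3,\tau_3:K(L\rtimes M\rtimes N)\to K(1\rtimes M\rtimes N)$ be the algebra maps $\sigma_3(\mathbf{e}_{l,m,n})=\mathbf{e}_{1,m,n}$,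 $\tau_3(\mathbf{e}_{l,m,n})=\mathbf{e}_{1,\partial_2(l)m,n}$, and $\sigma_2,\tau_2:K(1\rtimes M\rtimes N)\to K(1\rtimes1\rtimes N)$ the algebra maps $\sigma_2(\mathbf{e}_{1,m,n})=\mathbf{e}_{1,1,n}$, $\tau_2(\mathbf{e}_{1,m,n})=\mathbf{e}_{1,1,\partial_1(m)n}$. Let $J_2$ be the (two-sided) ideal of $K(L\rtimes M\rtimes N)$ generated by all elements $\mathbf{e}_{l'l,m,n}-\mathbf{e}_{l,m,n}-\mathbf{e}_{l',\partial_2(l)m,n}+\mathbf{e}_{1,\partial_2(l)m,n}$, $\mathbf{e}_{l'\,{}^{m'}l,m'm,n}-\mathbf{e}_{l,m,n}-\mathbf{e}_{l',m',\partial_1(m)n}+\mathbf{e}_{1,1,\partial_1(m)n}$, $\mathbf{e}_{1,m'm,n}-\mathbf{e}_{1,m,n}-\mathbf{e}_{1,m',\partial_1(m)n}+\mathbf{e}_{1,1,\partial_1(m)n}$, and let $J_1$ be the ideal of $K(1\rtimes M\rtimes N)$ generated by all elements of the last form ($l,l'\in L$, $m,m'\in M$, $n\in N$). Write $\overline{\mathbf{e}}$ for cosets. The maps above induce algebra maps $\overline{\sigma}_3,\overline{\tau}_3:K(L\rtimes M\rtimes N)/J_2\to K(1\rtimes M\rtimes N)/J_1$ and $\overline{\sigma}_2,\overline{\tau}_2:K(1\rtimes M\rtimes N)/J_1\to K(1\rtimes1\rtimes N)$; these data form $\overline{K(\mathfrak{C}^2)}$. **The complex $\overline{\delta}$.**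 $\mathrm{K}_3=\mathrm{Ker}\,\overline{\sigma}_3$, $\mathrm{K}_2=\mathrm{Ker}\,\overline{\sigma}_2$, $\mathrm{K}_1=K(1\rtimes1\rtimes N)$, regarded as vector spaces, with boundaries the restrictions of $\overline{\tau}_3$ and $\overline{\tau}_2$. $\mathrm{K}_2$ is spanned by $\overline{\mathbf{v}}^{11}_{1,m,n}=\overline{\mathbf{e}}_{1,m,n}-\overline{\mathbf{e}}_{1,1,n}$ and $\mathrm{K}_3$ by $\overline{\mathbf{v}}^{22}_{l,m,n}=\overline{\mathbf{e}}_{l,m,n}-\overline{\mathbf{e}}_{1,m,n}$. **Cells of $\mathbf{Ch}^2_K$ and $\mathbf{Aut}(\overline\delta)$.** For a complex $\delta=(C_2\xrightarrow{\delta_2}C_1\xrightarrow{\delta_1}C_0)$ of vector spaces, $\mathbf{Aut}(\delta)$ has single 0-cell $\delta$; its 1-cells are chain automorphisms $F=(F_2,F_1,F_0)$; its 2-cells are 1-homotopies $(H,F):F\Rightarrow G$, i.e. linear maps $H'_1:C_0\to C_1$, $H'_2:C_1\to C_2$ with $\delta_1H'_1=G_0-F_0$, $H'_1\delta_1+\delta_2H'_2=G_1-F_1$, $H'_2\delta_2=G_2-F_2$; its 3-cells are 2-homotopies $(H,F)\Rrightarrow(K,F)$ between 1-homotopies $F\Rightarrow G$, i.e. linear maps $\alpha':C_0\to C_2$ with $\delta_2\alpha'=K'_1-H'_1$ and $\alpha'\delta_1=K'_2-H'_2$.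
   Formalization: The definition of a 1-homotopy is corrected in sign: H'_1δ_1 − δ_2H'_2 = G_1 − F_1 and −H'_2δ_2 = G_2 − F_2 replace the printed equations with plus signs, under which (2) fails when char K ≠ 2. *)

theory Defs
  imports "HOL-Algebra.QuotRing" "HOL-Algebra.Module" "HOL-Algebra.Bij" "HOL-Library.Poly_Mapping"
begin

section \<open>2-crossed modules\<close>

record ('l, 'm, 'n) two_crossed_data =
  grpL :: "'l monoid"
  grpM :: "'m monoid"
  grpN :: "'n monoid"
  bdy2 :: "'l \<Rightarrow> 'm"
  bdy1 :: "'m \<Rightarrow> 'n"
  actM :: "'n \<Rightarrow> 'm \<Rightarrow> 'm"
  actL :: "'n \<Rightarrow> 'l \<Rightarrow> 'l"
  lift :: "'m \<Rightarrow> 'm \<Rightarrow> 'l"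

definition actML :: "('l, 'm, 'n) two_crossed_data \<Rightarrow> 'm \<Rightarrow> 'l \<Rightarrow> 'l" where
  "actML \<XX> m l = lift \<XX> (bdy2 \<XX> l) m \<otimes>\<^bsub>grpL \<XX>\<^esub> l"

locale two_crossed_module =
  fixes \<XX> :: "('l, 'm, 'n) two_crossed_data"
  assumes group_L: "group (grpL \<XX>)"
    and group_M: "group (grpM \<XX>)"
    and group_N: "group (grpN \<XX>)"
    and bdy2_hom: "bdy2 \<XX> \<in> hom (grpL \<XX>) (grpM \<XX>)"
    and bdy1_hom: "bdy1 \<XX> \<in> hom (grpM \<XX>) (grpN \<XX>)"
    and bdy1_bdy2: "l \<in> carrier (grpL \<XX>) \<Longrightarrow> bdy1 \<XX> (bdy2 \<XX> l) = \<one>\<^bsub>grpN \<XX>\<^esub>"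
    and actM_hom: "actM \<XX> \<in> hom (grpN \<XX>) (AutoGroup (grpM \<XX>))"
    and actL_hom: "actL \<XX> \<in> hom (grpN \<XX>) (AutoGroup (grpL \<XX>))"
    and bdy2_equivariant:
      "\<lbrakk>n \<in> carrier (grpN \<XX>); l \<in> carrier (grpL \<XX>)\<rbrakk> \<Longrightarrow> bdy2 \<XX> (actL \<XX> n l) = actM \<XX> n (bdy2 \<XX> l)"
    and bdy1_equivariant:
      "\<lbrakk>n \<in> carrier (grpN \<XX>); m \<in> carrier (grpM \<XX>)\<rbrakk> \<Longrightarrow>
        bdy1 \<XX> (actM \<XX> n m) = n \<otimes>\<^bsub>grpN \<XX>\<^esub> bdy1 \<XX> m \<otimes>\<^bsub>grpN \<XX>\<^esub> inv\<^bsub>grpN \<XX>\<^esub> n"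
    and lift_closed:
      "\<lbrakk>m \<in> carrier (grpM \<XX>); m' \<in> carrier (grpM \<XX>)\<rbrakk> \<Longrightarrow> lift \<XX> m m' \<in> carrier (grpL \<XX>)"
    and CM1:
      "\<lbrakk>m \<in> carrier (grpM \<XX>); m' \<in> carrier (grpM \<XX>)\<rbrakk> \<Longrightarrow>
        bdy2 \<XX> (lift \<XX> m m') =
          actM \<XX> (bdy1 \<XX> m) m' \<otimes>\<^bsub>grpM \<XX>\<^esub> m \<otimes>\<^bsub>grpM \<XX>\<^esub> inv\<^bsub>grpM \<XX>\<^esub> m' \<otimes>\<^bsub>grpM \<XX>\<^esub> inv\<^bsub>grpM \<XX>\<^esub> m"
    and CM2:
      "\<lbrakk>l \<in> carrier (grpL \<XX>); l' \<in> carrier (grpL \<XX>)\<rbrakk> \<Longrightarrow>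
        lift \<XX> (bdy2 \<XX> l) (bdy2 \<XX> l') =
          l' \<otimes>\<^bsub>grpL \<XX>\<^esub> l \<otimes>\<^bsub>grpL \<XX>\<^esub> inv\<^bsub>grpL \<XX>\<^esub> l' \<otimes>\<^bsub>grpL \<XX>\<^esub> inv\<^bsub>grpL \<XX>\<^esub> l"
    and CM3_i:
      "\<lbrakk>m \<in> carrier (grpM \<XX>); m' \<in> carrier (grpM \<XX>); m'' \<in> carrier (grpM \<XX>)\<rbrakk> \<Longrightarrow>
        lift \<XX> (m \<otimes>\<^bsub>grpM \<XX>\<^esub> m') m'' =
          actL \<XX> (bdy1 \<XX> m) (lift \<XX> m' m'') \<otimes>\<^bsub>grpL \<XX>\<^esub>
          lift \<XX> m (m' \<otimes>\<^bsub>grpM \<XX>\<^esub> m'' \<otimes>\<^bsub>grpM \<XX>\<^esub> inv\<^bsub>grpM \<XX>\<^esub> m')"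
    and CM3_ii:
      "\<lbrakk>m \<in> carrier (grpM \<XX>); m' \<in> carrier (grpM \<XX>); m'' \<in> carrier (grpM \<XX>)\<rbrakk> \<Longrightarrow>
        lift \<XX> m (m' \<otimes>\<^bsub>grpM \<XX>\<^esub> m'') =
          lift \<XX> m m' \<otimes>\<^bsub>grpL \<XX>\<^esub>
          actML \<XX> (m \<otimes>\<^bsub>grpM \<XX>\<^esub> m' \<otimes>\<^bsub>grpM \<XX>\<^esub> inv\<^bsub>grpM \<XX>\<^esub> m) (lift \<XX> m m'')"
    and CM4:
      "\<lbrakk>m \<in> carrier (grpM \<XX>); l \<in> carrier (grpL \<XX>)\<rbrakk> \<Longrightarrow>
        lift \<XX> m (bdy2 \<XX> l) \<otimes>\<^bsub>grpL \<XX>\<^esub> lift \<XX> (bdy2 \<XX> l) m =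
          actL \<XX> (bdy1 \<XX> m) l \<otimes>\<^bsub>grpL \<XX>\<^esub> inv\<^bsub>grpL \<XX>\<^esub> l"
    and CM5:
      "\<lbrakk>n \<in> carrier (grpN \<XX>); m \<in> carrier (grpM \<XX>); m' \<in> carrier (grpM \<XX>)\<rbrakk> \<Longrightarrow>
        actL \<XX> n (lift \<XX> m m') = lift \<XX> (actM \<XX> n m) (actM \<XX> n m')"


section \<open>The groups of cells\<close>

text \<open>The three groups share one element type: a 2-cell \<open>(m, n)\<close> is \<open>(1, m, n)\<close> and a 1-cell
  \<open>n\<close> is \<open>(1, 1, n)\<close>.\<close>

definition cells3 :: "('l, 'm, 'n) two_crossed_data \<Rightarrow> ('l \<times> 'm \<times> 'n) monoid" where
  "cells3 \<XX> = \<lparr>carrier = carrier (grpL \<XX>) \<times> carrier (grpM \<XX>) \<times> carrier (grpN \<XX>),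
     mult = (\<lambda>(l, m, n) (l', m', n').
       (l \<otimes>\<^bsub>grpL \<XX>\<^esub> actML \<XX> m (actL \<XX> n l'),
        m \<otimes>\<^bsub>grpM \<XX>\<^esub> actM \<XX> n m',
        n \<otimes>\<^bsub>grpN \<XX>\<^esub> n')),
     one = (\<one>\<^bsub>grpL \<XX>\<^esub>, \<one>\<^bsub>grpM \<XX>\<^esub>, \<one>\<^bsub>grpN \<XX>\<^esub>)\<rparr>"

definition cells2 :: "('l, 'm, 'n) two_crossed_data \<Rightarrow> ('l \<times> 'm \<times> 'n) monoid" where
  "cells2 \<XX> = (cells3 \<XX>)
     \<lparr>carrier := {\<one>\<^bsub>grpL \<XX>\<^esub>} \<times> carrier (grpM \<XX>) \<times> carrier (grpN \<XX>)\<rparr>"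

definition cells1 :: "('l, 'm, 'n) two_crossed_data \<Rightarrow> ('l \<times> 'm \<times> 'n) monoid" where
  "cells1 \<XX> = (cells3 \<XX>)
     \<lparr>carrier := {\<one>\<^bsub>grpL \<XX>\<^esub>} \<times> {\<one>\<^bsub>grpM \<XX>\<^esub>} \<times> carrier (grpN \<XX>)\<rparr>"


section \<open>Group algebras and their quotients\<close>

text \<open>Algebras over \<^typ>\<open>'k::field\<close> are records of type \<^typ>\<open>('k, 'a) module\<close>; the
  locale \<^locale>\<open>algebra\<close> does not apply, since it demands commutativity.\<close>

abbreviation basis :: "'g \<Rightarrow> ('g \<Rightarrow>\<^sub>0 'k::field)"  (\<open>\<e>\<close>) where
  "\<e> g \<equiv> Poly_Mapping.single g 1"

definition group_algebra :: "('g, 'x) monoid_scheme \<Rightarrow> ('k::field, 'g \<Rightarrow>\<^sub>0 'k) module" where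
  "group_algebra G = \<lparr>carrier = {f. Poly_Mapping.keys f \<subseteq> carrier G},
     mult = (\<lambda>f g. \<Sum>x\<in>Poly_Mapping.keys f. \<Sum>y\<in>Poly_Mapping.keys g.
       Poly_Mapping.single (x \<otimes>\<^bsub>G\<^esub> y) (Poly_Mapping.lookup f x * Poly_Mapping.lookup g y)),
     one = \<e> \<one>\<^bsub>G\<^esub>,
     zero = 0,
     add = (+),
     smult = (\<lambda>c. Poly_Mapping.map ((*) c))\<rparr>"

definition basis_map :: "('g \<Rightarrow> 'h) \<Rightarrow> ('g \<Rightarrow>\<^sub>0 'k::field) \<Rightarrow> ('h \<Rightarrow>\<^sub>0 'k)" where
  "basis_map \<phi> f = (\<Sum>x\<in>Poly_Mapping.keys f. Poly_Mapping.single (\<phi> x) (Poly_Mapping.lookup f x))"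

text \<open>\<^const>\<open>FactRing\<close> forgets the scalars, which are put back here.\<close>

definition quot_algebra :: "('k, 'a) module \<Rightarrow> 'a set \<Rightarrow> ('k, 'a set) module" where
  "quot_algebra A J = \<lparr>carrier = carrier (A Quot J), mult = mult (A Quot J), one = one (A Quot J),
     zero = zero (A Quot J), add = add (A Quot J),
     smult = (\<lambda>c U. \<Union>x\<in>U. J +>\<^bsub>A\<^esub> (c \<odot>\<^bsub>A\<^esub> x))\<rparr>"

type_synonym ('l, 'm, 'n, 'k) vec = "('l \<times> 'm \<times> 'n) \<Rightarrow>\<^sub>0 'k"

definition relators_vert2 ::
  "('l, 'm, 'n) two_crossed_data \<Rightarrow> ('l, 'm, 'n, 'k::field) vec set" where
  "relators_vert2 \<XX> =
     {\<e> (\<one>\<^bsub>grpL \<XX>\<^esub>, m' \<otimes>\<^bsub>grpM \<XX>\<^esub> m, n)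
        - \<e> (\<one>\<^bsub>grpL \<XX>\<^esub>, m, n)
        - \<e> (\<one>\<^bsub>grpL \<XX>\<^esub>, m', bdy1 \<XX> m \<otimes>\<^bsub>grpN \<XX>\<^esub> n)
        + \<e> (\<one>\<^bsub>grpL \<XX>\<^esub>, \<one>\<^bsub>grpM \<XX>\<^esub>, bdy1 \<XX> m \<otimes>\<^bsub>grpN \<XX>\<^esub> n)
      | m m' n. m \<in> carrier (grpM \<XX>) \<and> m' \<in> carrier (grpM \<XX>) \<and> n \<in> carrier (grpN \<XX>)}"

definition relators_2vert3 ::
  "('l, 'm, 'n) two_crossed_data \<Rightarrow> ('l, 'm, 'n, 'k::field) vec set" where
  "relators_2vert3 \<XX> =
     {\<e> (l' \<otimes>\<^bsub>grpL \<XX>\<^esub> l, m, n)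
        - \<e> (l, m, n)
        - \<e> (l', bdy2 \<XX> l \<otimes>\<^bsub>grpM \<XX>\<^esub> m, n)
        + \<e> (\<one>\<^bsub>grpL \<XX>\<^esub>, bdy2 \<XX> l \<otimes>\<^bsub>grpM \<XX>\<^esub> m, n)
      | l l' m n. l \<in> carrier (grpL \<XX>) \<and> l' \<in> carrier (grpL \<XX>) \<and>
          m \<in> carrier (grpM \<XX>) \<and> n \<in> carrier (grpN \<XX>)}"

definition relators_1vert3 ::
  "('l, 'm, 'n) two_crossed_data \<Rightarrow> ('l, 'm, 'n, 'k::field) vec set" where
  "relators_1vert3 \<XX> =
     {\<e> (l' \<otimes>\<^bsub>grpL \<XX>\<^esub> actML \<XX> m' l, m' \<otimes>\<^bsub>grpM \<XX>\<^esub> m, n)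
        - \<e> (l, m, n)
        - \<e> (l', m', bdy1 \<XX> m \<otimes>\<^bsub>grpN \<XX>\<^esub> n)
        + \<e> (\<one>\<^bsub>grpL \<XX>\<^esub>, \<one>\<^bsub>grpM \<XX>\<^esub>, bdy1 \<XX> m \<otimes>\<^bsub>grpN \<XX>\<^esub> n)
      | l l' m m' n. l \<in> carrier (grpL \<XX>) \<and> l' \<in> carrier (grpL \<XX>) \<and>
          m \<in> carrier (grpM \<XX>) \<and> m' \<in> carrier (grpM \<XX>) \<and> n \<in> carrier (grpN \<XX>)}"

definition J1 :: "('l, 'm, 'n) two_crossed_data \<Rightarrow> ('l, 'm, 'n, 'k::field) vec set" where
  "J1 \<XX> = genideal (group_algebra (cells2 \<XX>)) (relators_vert2 \<XX>)"

definition J2 :: "('l, 'm, 'n) two_crossed_data \<Rightarrow> ('l, 'm, 'n, 'k::field) vec set" where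
  "J2 \<XX> = genideal (group_algebra (cells3 \<XX>))
     (relators_2vert3 \<XX> \<union> relators_1vert3 \<XX> \<union> relators_vert2 \<XX>)"

definition alg3 ::
  "('l, 'm, 'n) two_crossed_data \<Rightarrow> ('k::field, ('l, 'm, 'n, 'k) vec set) module" where
  "alg3 \<XX> = quot_algebra (group_algebra (cells3 \<XX>)) (J2 \<XX>)"

definition alg2 ::
  "('l, 'm, 'n) two_crossed_data \<Rightarrow> ('k::field, ('l, 'm, 'n, 'k) vec set) module" where
  "alg2 \<XX> = quot_algebra (group_algebra (cells2 \<XX>)) (J1 \<XX>)"

definition alg1 ::
  "('l, 'm, 'n) two_crossed_data \<Rightarrow> ('k::field, ('l, 'm, 'n, 'k) vec) module" where
  "alg1 \<XX> = group_algebra (cells1 \<XX>)"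

definition sigma3 ::
  "('l, 'm, 'n) two_crossed_data \<Rightarrow> ('l, 'm, 'n, 'k::field) vec \<Rightarrow> ('l, 'm, 'n, 'k) vec" where
  "sigma3 \<XX> = basis_map (\<lambda>(l, m, n). (\<one>\<^bsub>grpL \<XX>\<^esub>, m, n))"

definition tau3 ::
  "('l, 'm, 'n) two_crossed_data \<Rightarrow> ('l, 'm, 'n, 'k::field) vec \<Rightarrow> ('l, 'm, 'n, 'k) vec" where
  "tau3 \<XX> = basis_map (\<lambda>(l, m, n). (\<one>\<^bsub>grpL \<XX>\<^esub>, bdy2 \<XX> l \<otimes>\<^bsub>grpM \<XX>\<^esub> m, n))"

definition sigma2 ::
  "('l, 'm, 'n) two_crossed_data \<Rightarrow> ('l, 'm, 'n, 'k::field) vec \<Rightarrow> ('l, 'm, 'n, 'k) vec" where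
  "sigma2 \<XX> = basis_map (\<lambda>(l, m, n). (\<one>\<^bsub>grpL \<XX>\<^esub>, \<one>\<^bsub>grpM \<XX>\<^esub>, n))"

definition tau2 ::
  "('l, 'm, 'n) two_crossed_data \<Rightarrow> ('l, 'm, 'n, 'k::field) vec \<Rightarrow> ('l, 'm, 'n, 'k) vec" where
  "tau2 \<XX> = basis_map (\<lambda>(l, m, n). (\<one>\<^bsub>grpL \<XX>\<^esub>, \<one>\<^bsub>grpM \<XX>\<^esub>, bdy1 \<XX> m \<otimes>\<^bsub>grpN \<XX>\<^esub> n))"

text \<open>The maps induced on cosets, in the style of \<open>FactGroup_the_elem_hom\<close>.\<close>

definition sigma3_bar :: "('l, 'm, 'n) two_crossed_data \<Rightarrow>
    ('l, 'm, 'n, 'k::field) vec set \<Rightarrow> ('l, 'm, 'n, 'k) vec set" where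
  "sigma3_bar \<XX> U = the_elem ((\<lambda>x. J1 \<XX> +>\<^bsub>group_algebra (cells2 \<XX>)\<^esub> sigma3 \<XX> x) ` U)"

definition tau3_bar :: "('l, 'm, 'n) two_crossed_data \<Rightarrow>
    ('l, 'm, 'n, 'k::field) vec set \<Rightarrow> ('l, 'm, 'n, 'k) vec set" where
  "tau3_bar \<XX> U = the_elem ((\<lambda>x. J1 \<XX> +>\<^bsub>group_algebra (cells2 \<XX>)\<^esub> tau3 \<XX> x) ` U)"

definition sigma2_bar :: "('l, 'm, 'n) two_crossed_data \<Rightarrow>
    ('l, 'm, 'n, 'k::field) vec set \<Rightarrow> ('l, 'm, 'n, 'k) vec" where
  "sigma2_bar \<XX> U = the_elem (sigma2 \<XX> ` U)"

definition tau2_bar :: "('l, 'm, 'n) two_crossed_data \<Rightarrow>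
    ('l, 'm, 'n, 'k::field) vec set \<Rightarrow> ('l, 'm, 'n, 'k) vec" where
  "tau2_bar \<XX> U = the_elem (tau2 \<XX> ` U)"


section \<open>Complexes of vector spaces of length 2 and their cells\<close>

definition field_of_scalars :: "'k::field ring" where
  "field_of_scalars = \<lparr>carrier = UNIV, mult = (*), one = 1, zero = 0, add = (+)\<rparr>"

abbreviation vect_space :: "('k::field, 'a) module \<Rightarrow> bool" where
  "vect_space V \<equiv> Module.module field_of_scalars V"

definition lin_map :: "('k, 'a) module \<Rightarrow> ('k, 'b) module \<Rightarrow> ('a \<Rightarrow> 'b) \<Rightarrow> bool" where
  "lin_map V W f \<longleftrightarrow> f \<in> carrier V \<rightarrow> carrier W \<and>
     (\<forall>x\<in>carrier V. \<forall>y\<in>carrier V. f (x \<oplus>\<^bsub>V\<^esub> y) = f x \<oplus>\<^bsub>W\<^esub> f y) \<and>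
     (\<forall>c. \<forall>x\<in>carrier V. f (c \<odot>\<^bsub>V\<^esub> x) = c \<odot>\<^bsub>W\<^esub> f x)"

record ('k, 'a, 'b, 'c) complex2 =
  deg2 :: "('k, 'a) module"
  deg1 :: "('k, 'b) module"
  deg0 :: "('k, 'c) module"
  diff2 :: "'a \<Rightarrow> 'b"
  diff1 :: "'b \<Rightarrow> 'c"

definition is_complex :: "('k::field, 'a, 'b, 'c) complex2 \<Rightarrow> bool" where
  "is_complex \<delta> \<longleftrightarrow>
     vect_space (deg2 \<delta>) \<and> vect_space (deg1 \<delta>) \<and> vect_space (deg0 \<delta>) \<and>
     lin_map (deg2 \<delta>) (deg1 \<delta>) (diff2 \<delta>) \<and> lin_map (deg1 \<delta>) (deg0 \<delta>) (diff1 \<delta>) \<and>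
     (\<forall>x\<in>carrier (deg2 \<delta>). diff1 \<delta> (diff2 \<delta> x) = \<zero>\<^bsub>deg0 \<delta>\<^esub>)"

type_synonym ('a, 'b, 'c) chain_map = "('a \<Rightarrow> 'a) \<times> ('b \<Rightarrow> 'b) \<times> ('c \<Rightarrow> 'c)"

definition chain_aut :: "('k::field, 'a, 'b, 'c) complex2 \<Rightarrow> ('a, 'b, 'c) chain_map \<Rightarrow> bool" where
  "chain_aut \<delta> F \<longleftrightarrow> (case F of (F2, F1, F0) \<Rightarrow>
     lin_map (deg2 \<delta>) (deg2 \<delta>) F2 \<and> bij_betw F2 (carrier (deg2 \<delta>)) (carrier (deg2 \<delta>)) \<and>
     lin_map (deg1 \<delta>) (deg1 \<delta>) F1 \<and> bij_betw F1 (carrier (deg1 \<delta>)) (carrier (deg1 \<delta>)) \<and>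
     lin_map (deg0 \<delta>) (deg0 \<delta>) F0 \<and> bij_betw F0 (carrier (deg0 \<delta>)) (carrier (deg0 \<delta>)) \<and>
     (\<forall>x\<in>carrier (deg2 \<delta>). F1 (diff2 \<delta> x) = diff2 \<delta> (F2 x)) \<and>
     (\<forall>x\<in>carrier (deg1 \<delta>). F0 (diff1 \<delta> x) = diff1 \<delta> (F1 x)))"

text \<open>Sign convention. The degree-one component \<open>H2\<close> of a 1-homotopy enters with a minus sign:
  it is the negative of the corresponding component of a classical chain homotopy. With the
  formulas below for 2-homotopies this sign is forced: if \<open>H\<close> and \<open>K\<close> are 1-homotopies with the
  same source and target, then \<open>(K1 - H1) \<circ> diff1\<close> equals \<open>diff2 \<circ> (K2 - H2)\<close>, as required by
  \<open>diff2 \<circ> \<alpha> = K1 - H1\<close> and \<open>\<alpha> \<circ> diff1 = K2 - H2\<close>. With the opposite sign of \<open>H2\<close> the same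
  two formulas would force \<open>2 (diff2 \<circ> \<alpha> \<circ> diff1) = 0\<close>.\<close>

definition one_homotopy :: "('k::field, 'a, 'b, 'c) complex2 \<Rightarrow>
    ('a, 'b, 'c) chain_map \<Rightarrow> ('a, 'b, 'c) chain_map \<Rightarrow> ('c \<Rightarrow> 'b) \<Rightarrow> ('b \<Rightarrow> 'a) \<Rightarrow> bool" where
  "one_homotopy \<delta> F G H1 H2 \<longleftrightarrow> (case (F, G) of ((F2, F1, F0), (G2, G1, G0)) \<Rightarrow>
     lin_map (deg0 \<delta>) (deg1 \<delta>) H1 \<and> lin_map (deg1 \<delta>) (deg2 \<delta>) H2 \<and>
     (\<forall>x\<in>carrier (deg0 \<delta>). diff1 \<delta> (H1 x) = G0 x \<ominus>\<^bsub>deg0 \<delta>\<^esub> F0 x) \<and>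
     (\<forall>x\<in>carrier (deg1 \<delta>).
        H1 (diff1 \<delta> x) \<ominus>\<^bsub>deg1 \<delta>\<^esub> diff2 \<delta> (H2 x) = G1 x \<ominus>\<^bsub>deg1 \<delta>\<^esub> F1 x) \<and>
     (\<forall>x\<in>carrier (deg2 \<delta>). \<ominus>\<^bsub>deg2 \<delta>\<^esub> H2 (diff2 \<delta> x) = G2 x \<ominus>\<^bsub>deg2 \<delta>\<^esub> F2 x))"

definition two_homotopy :: "('k::field, 'a, 'b, 'c) complex2 \<Rightarrow>
    ('a, 'b, 'c) chain_map \<Rightarrow> ('a, 'b, 'c) chain_map \<Rightarrow>
    ('c \<Rightarrow> 'b) \<times> ('b \<Rightarrow> 'a) \<Rightarrow> ('c \<Rightarrow> 'b) \<times> ('b \<Rightarrow> 'a) \<Rightarrow> ('c \<Rightarrow> 'a) \<Rightarrow> bool" where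
  "two_homotopy \<delta> F G H K \<alpha> \<longleftrightarrow> (case (H, K) of ((H1, H2), (K1, K2)) \<Rightarrow>
     one_homotopy \<delta> F G H1 H2 \<and> one_homotopy \<delta> F G K1 K2 \<and>
     lin_map (deg0 \<delta>) (deg2 \<delta>) \<alpha> \<and>
     (\<forall>x\<in>carrier (deg0 \<delta>). diff2 \<delta> (\<alpha> x) = K1 x \<ominus>\<^bsub>deg1 \<delta>\<^esub> H1 x) \<and>
     (\<forall>x\<in>carrier (deg1 \<delta>). \<alpha> (diff1 \<delta> x) = K2 x \<ominus>\<^bsub>deg2 \<delta>\<^esub> H2 x))"


section \<open>The complex of a 2-crossed module\<close>

definition K3 ::
  "('l, 'm, 'n) two_crossed_data \<Rightarrow> ('k::field, ('l, 'm, 'n, 'k) vec set) module" where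
  "K3 \<XX> = (alg3 \<XX>)\<lparr>carrier := a_kernel (alg3 \<XX>) (alg2 \<XX>) (sigma3_bar \<XX>)\<rparr>"

definition K2 ::
  "('l, 'm, 'n) two_crossed_data \<Rightarrow> ('k::field, ('l, 'm, 'n, 'k) vec set) module" where
  "K2 \<XX> = (alg2 \<XX>)\<lparr>carrier := a_kernel (alg2 \<XX>) (alg1 \<XX>) (sigma2_bar \<XX>)\<rparr>"

definition K1 ::
  "('l, 'm, 'n) two_crossed_data \<Rightarrow> ('k::field, ('l, 'm, 'n, 'k) vec) module" where
  "K1 \<XX> = alg1 \<XX>"

definition delta_bar :: "('l, 'm, 'n) two_crossed_data \<Rightarrow>
    ('k::field, ('l, 'm, 'n, 'k) vec set, ('l, 'm, 'n, 'k) vec set, ('l, 'm, 'n, 'k) vec) complex2"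
  where
  "delta_bar \<XX> = \<lparr>deg2 = K3 \<XX>, deg1 = K2 \<XX>, deg0 = K1 \<XX>,
     diff2 = tau3_bar \<XX>, diff1 = tau2_bar \<XX>\<rparr>"

definition e1 :: "('l, 'm, 'n) two_crossed_data \<Rightarrow> 'n \<Rightarrow> ('l, 'm, 'n, 'k::field) vec" where
  "e1 \<XX> n = \<e> (\<one>\<^bsub>grpL \<XX>\<^esub>, \<one>\<^bsub>grpM \<XX>\<^esub>, n)"

definition v11 ::
  "('l, 'm, 'n) two_crossed_data \<Rightarrow> 'm \<Rightarrow> 'n \<Rightarrow> ('l, 'm, 'n, 'k::field) vec set" where
  "v11 \<XX> m n =
     (J1 \<XX> +>\<^bsub>group_algebra (cells2 \<XX>)\<^esub> \<e> (\<one>\<^bsub>grpL \<XX>\<^esub>, m, n)) \<ominus>\<^bsub>alg2 \<XX>\<^esub>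
     (J1 \<XX> +>\<^bsub>group_algebra (cells2 \<XX>)\<^esub> \<e> (\<one>\<^bsub>grpL \<XX>\<^esub>, \<one>\<^bsub>grpM \<XX>\<^esub>, n))"

definition v22 ::
  "('l, 'm, 'n) two_crossed_data \<Rightarrow> 'l \<Rightarrow> 'm \<Rightarrow> 'n \<Rightarrow> ('l, 'm, 'n, 'k::field) vec set" where
  "v22 \<XX> l m n =
     (J2 \<XX> +>\<^bsub>group_algebra (cells3 \<XX>)\<^esub> \<e> (l, m, n)) \<ominus>\<^bsub>alg3 \<XX>\<^esub>
     (J2 \<XX> +>\<^bsub>group_algebra (cells3 \<XX>)\<^esub> \<e> (\<one>\<^bsub>grpL \<XX>\<^esub>, m, n))"

end

theory Submission
  imports Defs "HOL.Vector_Spaces"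
begin

text \<open>All the maps of the representation except \<open>\<lambda>''\<close> are multiplications in the quotient algebras.
  The 1-cell \<open>n\<close> acts by right multiplication with its own class, while \<open>\<lambda>'\<close> and \<open>\<alpha>'\<close> send \<open>\<e> n'\<close>
  to its product with \<open>v11 m n\<close>, respectively with \<open>v22 l m n\<close>; hence these maps are well defined for
  formal reasons. The map \<open>\<lambda>''\<close> involves the Peiffer lifting and is merely linear. It is well defined
  because \<open>J1\<close>, although introduced as a two-sided ideal, is already the linear span of its
  generators (\<open>J1_span\<close>), so that it has to be checked on these generators only (\<open>rep''_J1_J2\<close>).

  The computations rest on a normal form for 3-cells. Write \<open>W l n\<close> for the class of
  \<open>\<e> (l, 1, n) - \<e> (1, 1, n)\<close> modulo \<open>J2\<close> (\<open>loop3\<close> below). The relators say that \<open>v22 l m n\<close> equals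
  \<open>W l (\<partial>\<^sub>1 m n)\<close>, that \<open>W\<close> is additive in \<open>l\<close>, and that \<open>W (m \<star> l) (\<partial>\<^sub>1 m n) = W l n\<close>; similarly
  \<open>v11 (m' m) n = v11 m n + v11 m' (\<partial>\<^sub>1 m n)\<close> modulo \<open>J1\<close>. In particular commutators in \<open>L\<close> disappear,
  and each assertion with values in \<open>K3\<close> reduces essentially to one expansion rule for the Peiffer lifting:
  well-definedness of \<open>\<lambda>''\<close> to the expansion of \<open>\<lbrace>m' m, a\<rbrace>\<close>, its vertical additivity to that of
  \<open>\<lbrace>p, a' a\<rbrace>\<close>, the homotopy identity on \<open>K3\<close> to \<open>\<lbrace>\<partial>\<^sub>2 l, m\<rbrace> = (m \<star> l) l\<inverse>\<close>, and the 2-homotopy identity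
  to the expansion of \<open>\<lbrace>p, \<partial>\<^sub>2 l a\<rbrace>\<close>, in which \<open>N\<close> and \<open>M\<close> both act on \<open>l\<close>.

  Horizontal composites, and products of 3-cells, are vertical composites of whiskered cells, and
  whiskering by a 1-cell is strict. These laws therefore follow from the vertical ones.

  The spaces of the complex consist of cosets, on which linear algebra is awkward. Each of them is
  therefore presented by a subspace of representatives inside a type of finitely supported
  functions (locale \<open>presentation\<close>), and all identities are proved for representatives, on generators
  and modulo an ideal. A congruence modulo a subspace is in turn proved by applying an arbitrary
  linear map that vanishes there (\<open>mem_if_killed\<close>), which makes it an equation open to rewriting.\<close>


section \<open>Linear maps on finitely supported functions\<close>

abbreviation scale :: "'k::field \<Rightarrow> ('g \<Rightarrow>\<^sub>0 'k) \<Rightarrow> ('g \<Rightarrow>\<^sub>0 'k)"  (infixr \<open>*\<^sub>k\<close> 75) where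
  "c *\<^sub>k f \<equiv> Poly_Mapping.map ((*) c) f"

lemma lookup_scale [simp]: "Poly_Mapping.lookup (c *\<^sub>k f) x = c * Poly_Mapping.lookup f x"
  by (simp add: Poly_Mapping.map.rep_eq when_def)

global_interpretation fs: vector_space "scale :: 'k::field \<Rightarrow> ('g \<Rightarrow>\<^sub>0 'k) \<Rightarrow> ('g \<Rightarrow>\<^sub>0 'k)"
  by unfold_locales (auto intro!: poly_mapping_eqI simp: lookup_add algebra_simps)

abbreviation lin :: "(('g \<Rightarrow>\<^sub>0 'k::field) \<Rightarrow> ('h \<Rightarrow>\<^sub>0 'k)) \<Rightarrow> bool" where
  "lin F \<equiv> Vector_Spaces.linear scale scale F"

global_interpretation fs_pair: vector_space_pair
    "scale :: 'k::field \<Rightarrow> ('g \<Rightarrow>\<^sub>0 'k) \<Rightarrow> ('g \<Rightarrow>\<^sub>0 'k)"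
    "scale :: 'k::field \<Rightarrow> ('h \<Rightarrow>\<^sub>0 'k) \<Rightarrow> ('h \<Rightarrow>\<^sub>0 'k)"
  by unfold_locales

lemma linI:
  assumes "\<And>x y. F (x + y) = F x + F y" and "\<And>c x. F (c *\<^sub>k x) = c *\<^sub>k F x"
  shows "lin F"
  using assms by unfold_locales auto

lemma lin_add: "lin F \<Longrightarrow> F (x + y) = F x + F y"
  and lin_scale: "lin F \<Longrightarrow> F (c *\<^sub>k x) = c *\<^sub>k F x"
  and lin_diff: "lin F \<Longrightarrow> F (x - y) = F x - F y"
  and lin_zero: "lin F \<Longrightarrow> F 0 = 0"
  by (simp_all add: fs_pair.linear_add fs_pair.linear_scale fs_pair.linear_diff fs_pair.linear_0)

lemmas lin_simps = lin_add lin_scale lin_diff lin_zero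

lemma lin_id [simp]: "lin (\<lambda>x. x)"
  by (rule linI) auto

lemma lin_comp: "lin F \<Longrightarrow> lin G \<Longrightarrow> lin (\<lambda>x. F (G x))"
  by (rule linI) (simp_all add: lin_simps)

lemma lin_plus: "lin F \<Longrightarrow> lin G \<Longrightarrow> lin (\<lambda>x. F x + G x)"
  by (rule linI) (simp_all add: lin_simps fs.scale_right_distrib)

lemma lin_minus: "lin F \<Longrightarrow> lin G \<Longrightarrow> lin (\<lambda>x. F x - G x)"
  by (rule linI) (simp_all add: lin_simps fs.scale_right_diff_distrib)

lemma lin_0 [simp]: "lin (\<lambda>x. 0)"
  by (rule linI) auto

lemma lin_neg: "lin F \<Longrightarrow> lin (\<lambda>x. - F x)"
  using lin_minus[OF lin_0] by simp

definition lin_ext :: "('g \<Rightarrow> ('h \<Rightarrow>\<^sub>0 'k)) \<Rightarrow> ('g \<Rightarrow>\<^sub>0 'k::field) \<Rightarrow> ('h \<Rightarrow>\<^sub>0 'k)" where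
  "lin_ext \<phi> f = (\<Sum>x\<in>Poly_Mapping.keys f. Poly_Mapping.lookup f x *\<^sub>k \<phi> x)"

lemma lin_ext_superset:
  assumes "finite A" "Poly_Mapping.keys f \<subseteq> A"
  shows "lin_ext \<phi> f = (\<Sum>x\<in>A. Poly_Mapping.lookup f x *\<^sub>k \<phi> x)"
  unfolding lin_ext_def
  by (rule sum.mono_neutral_left) (use assms in \<open>auto simp: in_keys_iff\<close>)

lemma lin_lin_ext [simp]: "lin (lin_ext (\<phi> :: 'g \<Rightarrow> ('h \<Rightarrow>\<^sub>0 'k::field)))"
proof (rule linI)
  fix f g :: "'g \<Rightarrow>\<^sub>0 'k"
  let ?A = "Poly_Mapping.keys f \<union> Poly_Mapping.keys g"
  show "lin_ext \<phi> (f + g) = lin_ext \<phi> f + lin_ext \<phi> g"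
    using Poly_Mapping.keys_add[of f g]
    by (simp add: lin_ext_superset[of ?A] lookup_add fs.scale_left_distrib sum.distrib)
next
  fix c and f :: "'g \<Rightarrow>\<^sub>0 'k"
  have "Poly_Mapping.keys (c *\<^sub>k f) \<subseteq> Poly_Mapping.keys f"
    by (auto simp: in_keys_iff)
  then show "lin_ext \<phi> (c *\<^sub>k f) = c *\<^sub>k lin_ext \<phi> f"
    by (simp add: lin_ext_superset[of "Poly_Mapping.keys f"] fs.scale_sum_right)
qed

lemma scale_single [simp]: "c *\<^sub>k Poly_Mapping.single x d = Poly_Mapping.single x (c * d)"
  by (rule poly_mapping_eqI) (simp add: lookup_single when_def)

lemma lin_ext_basis [simp]: "lin_ext \<phi> (\<e> x) = \<phi> x"
  by (simp add: lin_ext_def)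

lemma lin_ext_e: "lin_ext \<e> f = f"
  by (rule poly_mapping_eqI)
    (auto simp: lin_ext_def lookup_sum lookup_single when_def in_keys_iff sum.delta)

lemma keys_subset_iff_span: "Poly_Mapping.keys f \<subseteq> A \<longleftrightarrow> f \<in> fs.span (\<e> ` A)"
proof
  assume "Poly_Mapping.keys f \<subseteq> A"
  then have "lin_ext \<e> f \<in> fs.span (\<e> ` A)"
    unfolding lin_ext_def by (intro fs.span_sum fs.span_scale fs.span_base) auto
  then show "f \<in> fs.span (\<e> ` A)"
    by (simp only: lin_ext_e)
next
  assume "f \<in> fs.span (\<e> ` A)"
  then show "Poly_Mapping.keys f \<subseteq> A"
  proof (induction rule: fs.span_induct_alt)
    case (step c x y)
    have "Poly_Mapping.keys (c *\<^sub>k x) \<subseteq> A"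
      using step by (auto split: if_splits)
    then show ?case using Poly_Mapping.keys_add[of "c *\<^sub>k x" y] step by blast
  qed simp
qed

lemma lin_map_span:
  assumes "lin F" "fs.subspace T" "\<And>x. x \<in> B \<Longrightarrow> F x \<in> T" "x \<in> fs.span B"
  shows "F x \<in> T"
  using assms(4)
  by (induction rule: fs.span_induct_alt)
    (use assms(1-3) in \<open>auto simp: lin_simps fs.subspace_0 intro!: fs.subspace_add fs.subspace_scale\<close>)

lemma lin_eq_span:
  fixes F G :: "('g \<Rightarrow>\<^sub>0 'k::field) \<Rightarrow> ('h \<Rightarrow>\<^sub>0 'k)"
  assumes "lin F" "lin G" "\<And>b. b \<in> B \<Longrightarrow> F b = G b" "x \<in> fs.span B"
  shows "F x = G x"
  using fs_pair.linear_eq_on[OF assms(1,2,4,3)] by blast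

lemma lin_map_keys:
  assumes "lin F" "fs.subspace T" "\<And>x. x \<in> A \<Longrightarrow> F (\<e> x) \<in> T" "Poly_Mapping.keys f \<subseteq> A"
  shows "F f \<in> T"
  using lin_map_span[OF assms(1,2), of "\<e> ` A" f] assms(3,4)
  by (auto simp: keys_subset_iff_span)

lemma lin_eq_keys:
  assumes "lin F" "lin G" "\<And>x. x \<in> A \<Longrightarrow> F (\<e> x) = G (\<e> x)" "Poly_Mapping.keys f \<subseteq> A"
  shows "F f = G f"
proof -
  have "F f - G f \<in> {0}"
    by (rule lin_map_keys[where A = A])
      (use assms in \<open>auto intro: lin_minus\<close>)
  then show ?thesis by simp
qed

lemma basis_map_lin_ext: "basis_map \<phi> = lin_ext (\<lambda>x. \<e> (\<phi> x))"
  by (auto simp: basis_map_def lin_ext_def fun_eq_iff)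

lemma lin_basis_map [simp]: "lin (basis_map \<phi>)"
  and basis_map_basis [simp]: "basis_map \<phi> (\<e> x) = \<e> (\<phi> x)"
  by (simp_all add: basis_map_lin_ext)

lemma keys_basis_map:
  assumes "\<And>x. x \<in> A \<Longrightarrow> \<phi> x \<in> B" "Poly_Mapping.keys f \<subseteq> A"
  shows "Poly_Mapping.keys (basis_map \<phi> f) \<subseteq> B"
proof -
  have "basis_map \<phi> f \<in> fs.span (\<e> ` B)"
    by (rule lin_map_keys[OF _ fs.subspace_span _ assms(2)]) (use assms(1) in \<open>auto intro: fs.span_base\<close>)
  then show ?thesis by (simp add: keys_subset_iff_span)
qed

text \<open>If \<open>basis_map \<phi>\<close> kills \<open>f\<close>, then \<open>f\<close> equals \<open>f - basis_map \<phi> f\<close>, and the latter is a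
  combination of the differences \<open>\<e> x - \<e> (\<phi> x)\<close>.\<close>

lemma basis_map_kernel_span:
  assumes "Poly_Mapping.keys f \<subseteq> A" "basis_map \<phi> f = 0"
  shows "f \<in> fs.span ((\<lambda>x. \<e> x - \<e> (\<phi> x)) ` A)"
proof -
  have "f - basis_map \<phi> f \<in> fs.span ((\<lambda>x. \<e> x - \<e> (\<phi> x)) ` A)"
    by (rule lin_map_keys[where A = A]) (use assms(1) in \<open>auto intro: fs.span_base lin_minus\<close>)
  then show ?thesis using assms(2) by simp
qed

text \<open>A subspace has a complement, so it is the kernel of a linear endomorphism. Congruences modulo
  the subspace thereby become equations, which can be used for rewriting.\<close>

lemma subspace_is_kernel:
  fixes J :: "('g \<Rightarrow>\<^sub>0 'k::field) set"
  assumes "fs.subspace J"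
  obtains p :: "('g \<Rightarrow>\<^sub>0 'k) \<Rightarrow> ('g \<Rightarrow>\<^sub>0 'k)" where "lin p" "\<And>x. p x = 0 \<longleftrightarrow> x \<in> J"
proof -
  obtain g where g: "range g \<subseteq> J" "lin g" "\<And>v. v \<in> J \<Longrightarrow> g v = v"
    using fs_pair.linear_exists_left_inverse_on[OF lin_id assms] by auto
  show thesis
  proof
    show "lin (\<lambda>x. x - g x)" by (intro lin_minus g lin_id)
    show "x - g x = 0 \<longleftrightarrow> x \<in> J" for x
      using g(1) g(3)[of x] by (metis eq_iff_diff_eq_0 range_subsetD)
  qed
qed

section \<open>Group algebras\<close>

abbreviation alg_mult :: "('g, 'x) monoid_scheme \<Rightarrow> ('g \<Rightarrow>\<^sub>0 'k::field) \<Rightarrow> ('g \<Rightarrow>\<^sub>0 'k) \<Rightarrow> ('g \<Rightarrow>\<^sub>0 'k)" where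
  "alg_mult G \<equiv> mult (group_algebra G)"

lemma group_algebra_simps [simp]:
  "zero (group_algebra G) = 0" "add (group_algebra G) = (+)" "one (group_algebra G) = \<e> \<one>\<^bsub>G\<^esub>"
  "smult (group_algebra G) = scale"
  "x \<in> carrier (group_algebra G) \<longleftrightarrow> Poly_Mapping.keys x \<subseteq> carrier G"
  by (simp_all add: group_algebra_def)

lemma alg_mult_lin_ext:
  "alg_mult G f g = lin_ext (\<lambda>x. basis_map (\<lambda>y. x \<otimes>\<^bsub>G\<^esub> y) g) f"
  by (simp add: group_algebra_def lin_ext_def basis_map_def fs.scale_sum_right)

lemma lin_alg_mult_left: "lin (\<lambda>f. alg_mult G f g)"
  by (simp add: alg_mult_lin_ext[abs_def])

lemma lin_alg_mult_right: "lin (\<lambda>g. alg_mult G f g)"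
proof (rule linI)
  fix g h c
  show "alg_mult G f (g + h) = alg_mult G f g + alg_mult G f h"
    by (simp add: alg_mult_lin_ext lin_ext_def lin_simps fs.scale_right_distrib sum.distrib)
  show "alg_mult G f (c *\<^sub>k g) = c *\<^sub>k alg_mult G f g"
    by (simp add: alg_mult_lin_ext lin_ext_def lin_simps fs.scale_sum_right mult.commute)
qed

lemma alg_mult_basis [simp]: "alg_mult G (\<e> x) (\<e> y) = \<e> (x \<otimes>\<^bsub>G\<^esub> y)"
  by (simp add: alg_mult_lin_ext)

lemma keys_alg_mult:
  assumes G: "group G" and f: "Poly_Mapping.keys f \<subseteq> carrier G" and g: "Poly_Mapping.keys g \<subseteq> carrier G"
  shows "Poly_Mapping.keys (alg_mult G f g) \<subseteq> carrier G"
proof -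
  interpret group G by (fact G)
  have "alg_mult G f g \<in> fs.span (\<e> ` carrier G)"
    by (intro lin_map_keys[OF lin_alg_mult_left _ _ f] lin_map_keys[OF lin_alg_mult_right _ _ g])
      (auto intro: fs.span_base)
  then show ?thesis by (simp add: keys_subset_iff_span)
qed

lemma abelian_group_group_algebra: "abelian_group (group_algebra G :: ('k::field, 'g \<Rightarrow>\<^sub>0 'k) module)"
proof (rule abelian_groupI)
  fix x y :: "'g \<Rightarrow>\<^sub>0 'k"
  assume "x \<in> carrier (group_algebra G)" "y \<in> carrier (group_algebra G)"
  then show "x \<oplus>\<^bsub>group_algebra G\<^esub> y \<in> carrier (group_algebra G)"
    using Poly_Mapping.keys_add[of x y] by auto
next
  fix x :: "'g \<Rightarrow>\<^sub>0 'k"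
  assume "x \<in> carrier (group_algebra G)"
  then show "\<exists>y\<in>carrier (group_algebra G). y \<oplus>\<^bsub>group_algebra G\<^esub> x = \<zero>\<^bsub>group_algebra G\<^esub>"
    by (intro bexI[of _ "- x"]) auto
qed (auto simp: add.commute add.left_commute)

lemma ring_group_algebra:
  assumes "group G"
  shows "ring (group_algebra G :: ('k::field, 'g \<Rightarrow>\<^sub>0 'k) module)"
proof -
  interpret group G by (fact assms)
  let ?A = "group_algebra G :: ('k, 'g \<Rightarrow>\<^sub>0 'k) module"
  note lins = lin_comp[OF lin_alg_mult_left] lin_comp[OF lin_alg_mult_right] lin_alg_mult_left
    lin_alg_mult_right lin_id
  show ?thesis
  proof (rule ringI)
    show "abelian_group ?A" by (rule abelian_group_group_algebra)
    show "monoid ?A"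
    proof (rule monoidI)
      fix x y z :: "'g \<Rightarrow>\<^sub>0 'k"
      assume x: "x \<in> carrier ?A" and y: "y \<in> carrier ?A" and z: "z \<in> carrier ?A"
      show "x \<otimes>\<^bsub>?A\<^esub> y \<in> carrier ?A" using keys_alg_mult[OF assms] x y by simp
      show "x \<otimes>\<^bsub>?A\<^esub> y \<otimes>\<^bsub>?A\<^esub> z = x \<otimes>\<^bsub>?A\<^esub> (y \<otimes>\<^bsub>?A\<^esub> z)"
        by (rule lin_eq_keys[where f = x and A = "carrier G"], (intro lins)+,
            rule lin_eq_keys[where f = y and A = "carrier G"], (intro lins)+,
            rule lin_eq_keys[where f = z and A = "carrier G"], (intro lins)+)
          (use x y z in \<open>auto simp: m_assoc\<close>)
      show "\<one>\<^bsub>?A\<^esub> \<otimes>\<^bsub>?A\<^esub> x = x"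
        by (rule lin_eq_keys[where f = x and A = "carrier G"], (intro lins)+) (use x in auto)
      show "x \<otimes>\<^bsub>?A\<^esub> \<one>\<^bsub>?A\<^esub> = x"
        by (rule lin_eq_keys[where f = x and A = "carrier G"], (intro lins)+) (use x in auto)
    qed simp
  qed (auto simp: lin_add[OF lin_alg_mult_left] lin_add[OF lin_alg_mult_right])
qed

lemma ring_hom_basis_map:
  assumes G: "group G" and H: "group H" and \<phi>: "\<phi> \<in> hom G H"
  shows "ring_hom_ring (group_algebra G :: ('k::field, _) module) (group_algebra H) (basis_map \<phi>)"
proof -
  interpret GH: group_hom G H \<phi> by (intro group_hom.intro group_hom_axioms.intro assms)
  show ?thesis
  proof (rule ring_hom_ringI[OF ring_group_algebra[OF G] ring_group_algebra[OF H]])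
    fix x y :: "'a \<Rightarrow>\<^sub>0 'k"
    assume x: "x \<in> carrier (group_algebra G)"
    show "basis_map \<phi> x \<in> carrier (group_algebra H)"
      using x keys_basis_map[of "carrier G" \<phi> "carrier H" x] by auto
    show "basis_map \<phi> (x \<oplus>\<^bsub>group_algebra G\<^esub> y) = basis_map \<phi> x \<oplus>\<^bsub>group_algebra H\<^esub> basis_map \<phi> y"
      by (simp add: lin_add)
    assume y: "y \<in> carrier (group_algebra G)"
    show "basis_map \<phi> (x \<otimes>\<^bsub>group_algebra G\<^esub> y) = basis_map \<phi> x \<otimes>\<^bsub>group_algebra H\<^esub> basis_map \<phi> y"
      by (rule lin_eq_keys[where f = x and A = "carrier G"],
          intro lin_comp[OF lin_basis_map] lin_alg_mult_left,
          intro lin_comp[OF lin_alg_mult_left] lin_basis_map,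
          rule lin_eq_keys[where f = y and A = "carrier G"],
          intro lin_comp[OF lin_basis_map] lin_alg_mult_right,
          intro lin_comp[OF lin_alg_mult_right] lin_basis_map)
       (use x y in auto)
  qed simp
qed

section \<open>Vector spaces presented as subquotients\<close>

text \<open>The locale replaces a vector space \<open>V\<close> whose elements form a carrier set by the quotient of
  \<open>S\<close> by \<open>S \<inter> J\<close>, with \<open>q\<close> as quotient map: statements about linear maps between such spaces become
  statements about linear maps of representatives, modulo \<open>J\<close>. The set \<open>J\<close> need not be contained
  in \<open>S\<close>; in the application \<open>J\<close> is an ideal of the whole group algebra, whereas \<open>S\<close> represents the
  kernel of a source map.\<close>

locale presentation =
  fixes V :: "('k::field, 'a) module" and q :: "('g \<Rightarrow>\<^sub>0 'k) \<Rightarrow> 'a" and S J :: "('g \<Rightarrow>\<^sub>0 'k) set"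
  assumes subspace_S: "fs.subspace S" and subspace_J: "fs.subspace J"
    and carrier_V: "carrier V = q ` S"
    and zero_V: "\<zero>\<^bsub>V\<^esub> = q 0"
    and add_q: "\<lbrakk>x \<in> S; y \<in> S\<rbrakk> \<Longrightarrow> q x \<oplus>\<^bsub>V\<^esub> q y = q (x + y)"
    and smult_q: "x \<in> S \<Longrightarrow> c \<odot>\<^bsub>V\<^esub> q x = q (c *\<^sub>k x)"
    and eq_q_iff: "\<lbrakk>x \<in> S; y \<in> S\<rbrakk> \<Longrightarrow> q x = q y \<longleftrightarrow> x - y \<in> J"
begin

lemmas closed = fs.subspace_0[OF subspace_S] fs.subspace_add[OF subspace_S]
  fs.subspace_scale[OF subspace_S] fs.subspace_diff[OF subspace_S] fs.subspace_neg[OF subspace_S]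

lemma abelian_group_V: "abelian_group V"
proof (rule abelian_groupI)
  fix u assume "u \<in> carrier V"
  then obtain x where "x \<in> S" "u = q x" by (auto simp: carrier_V)
  then show "\<exists>y\<in>carrier V. y \<oplus>\<^bsub>V\<^esub> u = \<zero>\<^bsub>V\<^esub>"
    by (intro bexI[of _ "q (- x)"]) (auto simp: carrier_V zero_V add_q closed)
qed (auto simp: carrier_V zero_V add_q closed add.commute add.left_commute)

lemma vect_space_V: "vect_space V"
proof (rule Module.moduleI)
  show "cring (field_of_scalars :: 'k ring)"
    by (intro cringI abelian_groupI comm_monoidI)
      (auto simp: field_of_scalars_def algebra_simps intro: exI[of _ "- x" for x])
  show "abelian_group V" by (rule abelian_group_V)
qed (auto simp: field_of_scalars_def carrier_V smult_q add_q closed fs.scale_left_distrib fs.scale_right_distrib)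

lemma uminus_q: "x \<in> S \<Longrightarrow> \<ominus>\<^bsub>V\<^esub> q x = q (- x)"
  by (rule abelian_group.minus_equality[OF abelian_group_V])
    (auto simp: carrier_V zero_V add_q closed)

lemma minus_q: "\<lbrakk>x \<in> S; y \<in> S\<rbrakk> \<Longrightarrow> q x \<ominus>\<^bsub>V\<^esub> q y = q (x - y)"
  by (simp add: a_minus_def uminus_q add_q closed)

lemma add_commute: "\<lbrakk>u \<in> carrier V; v \<in> carrier V\<rbrakk> \<Longrightarrow> u \<oplus>\<^bsub>V\<^esub> v = v \<oplus>\<^bsub>V\<^esub> u"
  by (auto simp: carrier_V add_q add.commute)

lemma restrict:
  assumes "fs.subspace T" "T \<subseteq> S" "C = q ` T"
  shows "presentation (V\<lparr>carrier := C\<rparr>) q T J"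
  using assms subspace_J
  by unfold_locales (auto simp: zero_V add_q smult_q eq_q_iff subset_eq)

end

text \<open>The representative is chosen arbitrarily. The choice does not matter if \<open>F\<close> maps the kernel of
  \<open>q\<close> into the kernel of \<open>q'\<close>.\<close>

definition induced ::
  "(('g \<Rightarrow>\<^sub>0 'k) \<Rightarrow> 'a) \<Rightarrow> ('g \<Rightarrow>\<^sub>0 'k) set \<Rightarrow> (('h \<Rightarrow>\<^sub>0 'k) \<Rightarrow> 'b) \<Rightarrow>
    (('g \<Rightarrow>\<^sub>0 'k) \<Rightarrow> ('h \<Rightarrow>\<^sub>0 'k::field)) \<Rightarrow> 'a \<Rightarrow> 'b" where
  "induced q S q' F u = q' (F (SOME x. x \<in> S \<and> q x = u))"

locale presentation_pair = V: presentation V q S J + W: presentation W q' T I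
  for V :: "('k::field, 'a) module" and q and S J :: "('g \<Rightarrow>\<^sub>0 'k) set"
    and W :: "('k::field, 'b) module" and q' and T I :: "('h \<Rightarrow>\<^sub>0 'k) set"
begin

lemma induced_eq:
  assumes "lin F" "\<And>x. x \<in> S \<Longrightarrow> F x \<in> T" "\<And>x. x \<in> J \<Longrightarrow> F x \<in> I" "x \<in> S"
  shows "induced q S q' F (q x) = q' (F x)"
proof -
  define y where "y = (SOME y. y \<in> S \<and> q y = q x)"
  have y: "y \<in> S \<and> q y = q x"
    unfolding y_def by (rule someI[of _ x]) (use assms(4) in simp)
  then have "F (y - x) \<in> I"
    using assms(3,4) V.eq_q_iff by blast
  then show ?thesis
    using W.eq_q_iff[of "F y" "F x"] y assms by (simp add: induced_def y_def[symmetric] lin_simps)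
qed

lemma lin_mapI:
  assumes "lin F" "\<And>x. x \<in> S \<Longrightarrow> F x \<in> T" "\<And>x. x \<in> S \<Longrightarrow> f (q x) = q' (F x)"
  shows "lin_map V W f"
  unfolding lin_map_def V.carrier_V W.carrier_V
  using assms(2,3)
  by (auto simp: V.add_q W.add_q V.smult_q W.smult_q V.closed lin_simps[OF assms(1)])

lemma q'_eqI:
  assumes "lin F" "lin G" "\<And>x. x \<in> S \<Longrightarrow> F x \<in> T" "\<And>x. x \<in> S \<Longrightarrow> G x \<in> T"
    and "\<And>b. b \<in> B \<Longrightarrow> F b - G b \<in> I" and "x \<in> S" "S \<subseteq> fs.span B"
  shows "q' (F x) = q' (G x)"
proof -
  have "F x - G x \<in> I"
    by (rule lin_map_span[where B = B]) (use assms W.subspace_J in \<open>auto intro: lin_minus\<close>)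
  then show ?thesis using assms by (simp add: W.eq_q_iff)
qed

end

section \<open>Quotients of group algebras\<close>

lemma subspace_keys: "fs.subspace {x. Poly_Mapping.keys x \<subseteq> A}"
  by (simp add: keys_subset_iff_span)

lemma ideal_group_algebra_subspace:
  assumes "group G" and "ideal J (group_algebra G :: ('k::field, 'g \<Rightarrow>\<^sub>0 'k) module)"
  shows "fs.subspace J"
proof -
  interpret group G by (fact assms)
  interpret I: ideal J "group_algebra G" by (fact assms)
  show ?thesis
  proof (rule fs.subspaceI)
    fix c x assume x: "x \<in> J"
    have "alg_mult G (c *\<^sub>k \<e> \<one>\<^bsub>G\<^esub>) x \<in> J"
      using x by (intro I.I_l_closed) auto
    moreover have "alg_mult G (\<e> \<one>\<^bsub>G\<^esub>) x = x"
      using I.l_one[of x] I.Icarr[OF x] by simp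
    then have "alg_mult G (c *\<^sub>k \<e> \<one>\<^bsub>G\<^esub>) x = c *\<^sub>k x"
      by (simp only: lin_scale[OF lin_alg_mult_left])
    ultimately show "c *\<^sub>k x \<in> J" by simp
  qed (use additive_subgroup.zero_closed[OF I.additive_subgroup_axioms]
      additive_subgroup.a_closed[OF I.additive_subgroup_axioms] in auto)
qed

lemma coset_group_algebra: "J +>\<^bsub>group_algebra G\<^esub> x = (\<lambda>j. j + x) ` J"
  by (auto simp: a_r_coset_def')

lemma coset_group_algebra_eq_iff:
  assumes "fs.subspace J"
  shows "J +>\<^bsub>group_algebra G\<^esub> x = J +>\<^bsub>group_algebra G\<^esub> y \<longleftrightarrow> x - y \<in> J"
proof
  assume "J +>\<^bsub>group_algebra G\<^esub> x = J +>\<^bsub>group_algebra G\<^esub> y"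
  moreover have "x \<in> J +>\<^bsub>group_algebra G\<^esub> x"
    using fs.subspace_0[OF assms] by (force simp: coset_group_algebra)
  ultimately show "x - y \<in> J"
    by (auto simp: coset_group_algebra)
next
  assume xy: "x - y \<in> J"
  have "j + x \<in> (\<lambda>j. j + y) ` J" if "j \<in> J" for j
    by (rule image_eqI[of _ _ "j + (x - y)"]) (use that xy fs.subspace_add[OF assms] in auto)
  moreover have "j + y \<in> (\<lambda>j. j + x) ` J" if "j \<in> J" for j
    by (rule image_eqI[of _ _ "j - (x - y)"]) (use that xy fs.subspace_diff[OF assms] in auto)
  ultimately show "J +>\<^bsub>group_algebra G\<^esub> x = J +>\<^bsub>group_algebra G\<^esub> y"
    by (auto simp: coset_group_algebra)
qed

lemma presentation_quot_algebra:
  assumes "group G" and "ideal J (group_algebra G :: ('k::field, 'g \<Rightarrow>\<^sub>0 'k) module)"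
  shows "presentation (quot_algebra (group_algebra G) J) (\<lambda>x. J +>\<^bsub>group_algebra G\<^esub> x)
    {x. Poly_Mapping.keys x \<subseteq> carrier G} J"
proof -
  interpret I: ideal J "group_algebra G" by (fact assms)
  have J: "fs.subspace J" by (rule ideal_group_algebra_subspace[OF assms])
  have scale: "(\<Union>y\<in>J +>\<^bsub>group_algebra G\<^esub> x. J +>\<^bsub>group_algebra G\<^esub> (c *\<^sub>k y)) =
      J +>\<^bsub>group_algebra G\<^esub> (c *\<^sub>k x)" for c x
  proof -
    have "J +>\<^bsub>group_algebra G\<^esub> (c *\<^sub>k y) = J +>\<^bsub>group_algebra G\<^esub> (c *\<^sub>k x)"
      if "y \<in> J +>\<^bsub>group_algebra G\<^esub> x" for y
      using that fs.subspace_scale[OF J]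
      unfolding coset_group_algebra_eq_iff[OF J]
      by (auto simp: coset_group_algebra fs.scale_right_distrib)
    moreover have "x \<in> J +>\<^bsub>group_algebra G\<^esub> x"
      using fs.subspace_0[OF J] by (force simp: coset_group_algebra)
    ultimately show ?thesis by blast
  qed
  show ?thesis
  proof
    fix x y :: "'g \<Rightarrow>\<^sub>0 'k"
    assume "x \<in> {x. Poly_Mapping.keys x \<subseteq> carrier G}" "y \<in> {x. Poly_Mapping.keys x \<subseteq> carrier G}"
    then show "(J +>\<^bsub>group_algebra G\<^esub> x) \<oplus>\<^bsub>quot_algebra (group_algebra G) J\<^esub> (J +>\<^bsub>group_algebra G\<^esub> y) =
        J +>\<^bsub>group_algebra G\<^esub> (x + y)"
      using I.a_rcos_sum[of x y] by (simp add: quot_algebra_def FactRing_def)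
  qed (auto simp: subspace_keys J quot_algebra_def FactRing_def A_RCOSETS_def' scale
      coset_group_algebra_eq_iff[OF J] coset_group_algebra[of _ _ 0])
qed

text \<open>The preimage of \<open>I\<close> is an ideal containing \<open>B\<close>, hence contains the ideal that \<open>B\<close>
  generates.\<close>

lemma genideal_group_algebra_mono:
  assumes "ring_hom_ring (group_algebra G) (group_algebra H) f" "ideal I (group_algebra H)"
    and "B \<subseteq> carrier (group_algebra G)" "\<And>b. b \<in> B \<Longrightarrow> f b \<in> I"
    and "x \<in> genideal (group_algebra G) B"
  shows "f x \<in> I"
proof -
  interpret ring_hom_ring "group_algebra G" "group_algebra H" f by (fact assms)
  have "genideal (group_algebra G) B \<subseteq> {x \<in> carrier (group_algebra G). f x \<in> I}"
    by (rule R.genideal_minimal[OF ideal_vimage[OF assms(2)]]) (use assms(3,4) in blast)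
  then show ?thesis using assms(5) by blast
qed

text \<open>Multiplication is bilinear, so a span is an ideal as soon as the group
  elements map its generators into it.\<close>

lemma ideal_spanI:
  fixes R :: "('g \<Rightarrow>\<^sub>0 'k::field) set"
  assumes G: "group G" and R: "\<And>r. r \<in> R \<Longrightarrow> Poly_Mapping.keys r \<subseteq> carrier G"
    and left: "\<And>g r. \<lbrakk>g \<in> carrier G; r \<in> R\<rbrakk> \<Longrightarrow> alg_mult G (\<e> g) r \<in> fs.span R"
    and right: "\<And>g r. \<lbrakk>g \<in> carrier G; r \<in> R\<rbrakk> \<Longrightarrow> alg_mult G r (\<e> g) \<in> fs.span R"
  shows "ideal (fs.span R) (group_algebra G)"
proof (rule idealI)
  interpret A: ring "group_algebra G :: ('k, 'g \<Rightarrow>\<^sub>0 'k) module" by (rule ring_group_algebra[OF G])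
  show "ring (group_algebra G :: ('k, 'g \<Rightarrow>\<^sub>0 'k) module)" by (rule A.ring_axioms)
  show "subgroup (fs.span R) (add_monoid (group_algebra G))"
  proof (rule A.add.subgroupI)
    show "fs.span R \<subseteq> carrier (group_algebra G)"
      using fs.span_minimal[OF _ subspace_keys, of R "carrier G"] R by (simp add: subset_eq)
    fix x assume x: "x \<in> fs.span R"
    with \<open>fs.span R \<subseteq> carrier (group_algebra G)\<close>
    have "\<ominus>\<^bsub>group_algebra G\<^esub> x = - x"
      by (intro A.minus_equality) (auto simp del: group_algebra_simps(5) simp: fs.span_neg subset_eq)
    with x show "\<ominus>\<^bsub>group_algebra G\<^esub> x \<in> fs.span R" by (simp add: fs.span_neg)
  qed (auto simp: fs.span_add intro: fs.span_zero)
next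
  fix a x :: "'g \<Rightarrow>\<^sub>0 'k" assume x: "x \<in> fs.span R" and a: "a \<in> carrier (group_algebra G)"
  show "alg_mult G a x \<in> fs.span R"
    by (rule lin_map_keys[OF lin_alg_mult_left fs.subspace_span],
        rule lin_map_span[OF lin_alg_mult_right fs.subspace_span]) (use left x a in auto)
  show "alg_mult G x a \<in> fs.span R"
    by (rule lin_map_keys[OF lin_alg_mult_right fs.subspace_span],
        rule lin_map_span[OF lin_alg_mult_left fs.subspace_span]) (use right x a in auto)
qed

section \<open>Calculus in a 2-crossed module\<close>

lemma AutoGroup_action:
  assumes "group N" "group M" "act \<in> hom N (AutoGroup M)"
    and "n \<in> carrier N" "n' \<in> carrier N" "m \<in> carrier M"
  shows "group_hom M M (act n)"
    and "act (n \<otimes>\<^bsub>N\<^esub> n') m = act n (act n' m)"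
    and "act \<one>\<^bsub>N\<^esub> m = m"
proof -
  interpret N: group N by (fact assms)
  interpret M: group M by (fact assms)
  have auto: "act n \<in> auto M" if "n \<in> carrier N" for n
    using hom_in_carrier[OF assms(3) that] by (simp add: AutoGroup_def)
  then show "group_hom M M (act n)"
    using assms(2,4) by (auto simp: auto_def group_hom_def group_hom_axioms_def)
  have Bij: "act n \<in> Bij (carrier M)" if "n \<in> carrier N" for n
    using auto[OF that] by (simp add: auto_def)
  show "act (n \<otimes>\<^bsub>N\<^esub> n') m = act n (act n' m)"
    using hom_mult[OF assms(3-5)] assms(4-6) Bij
    by (simp add: AutoGroup_def BijGroup_def compose_def)
  interpret AutoGroup: group "AutoGroup M" by (rule M.AutoGroup)
  have "act \<one>\<^bsub>N\<^esub> = \<one>\<^bsub>AutoGroup M\<^esub>"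
    using assms(1,3) by (intro hom_one AutoGroup.is_group)
  then show "act \<one>\<^bsub>N\<^esub> m = m"
    using assms(6) by (simp add: AutoGroup_def BijGroup_def)
qed

text \<open>With associativity these rules let the simplifier solve the word problem for groups.\<close>

lemma (in group) inv_cancel_left [simp]:
  "\<lbrakk>x \<in> carrier G; y \<in> carrier G\<rbrakk> \<Longrightarrow> inv x \<otimes> (x \<otimes> y) = y"
  "\<lbrakk>x \<in> carrier G; y \<in> carrier G\<rbrakk> \<Longrightarrow> x \<otimes> (inv x \<otimes> y) = y"
  by (simp_all add: m_assoc[symmetric])

context two_crossed_module
begin

abbreviation carL  (\<open>L\<close>) where "L \<equiv> carrier (grpL \<XX>)"
abbreviation carM  (\<open>M\<close>) where "M \<equiv> carrier (grpM \<XX>)"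
abbreviation carN  (\<open>N\<close>) where "N \<equiv> carrier (grpN \<XX>)"
abbreviation mulL  (infixl \<open>\<cdot>\<^sub>L\<close> 70) where "a \<cdot>\<^sub>L b \<equiv> a \<otimes>\<^bsub>grpL \<XX>\<^esub> b"
abbreviation mulM  (infixl \<open>\<cdot>\<^sub>M\<close> 70) where "a \<cdot>\<^sub>M b \<equiv> a \<otimes>\<^bsub>grpM \<XX>\<^esub> b"
abbreviation mulN  (infixl \<open>\<cdot>\<^sub>N\<close> 70) where "a \<cdot>\<^sub>N b \<equiv> a \<otimes>\<^bsub>grpN \<XX>\<^esub> b"
abbreviation invL  (\<open>inv\<^sub>L _\<close> [81] 80) where "inv\<^sub>L a \<equiv> inv\<^bsub>grpL \<XX>\<^esub> a"
abbreviation invM  (\<open>inv\<^sub>M _\<close> [81] 80) where "inv\<^sub>M a \<equiv> inv\<^bsub>grpM \<XX>\<^esub> a"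
abbreviation invN  (\<open>inv\<^sub>N _\<close> [81] 80) where "inv\<^sub>N a \<equiv> inv\<^bsub>grpN \<XX>\<^esub> a"
abbreviation oneL  (\<open>\<one>\<^sub>L\<close>) where "\<one>\<^sub>L \<equiv> \<one>\<^bsub>grpL \<XX>\<^esub>"
abbreviation oneM  (\<open>\<one>\<^sub>M\<close>) where "\<one>\<^sub>M \<equiv> \<one>\<^bsub>grpM \<XX>\<^esub>"
abbreviation oneN  (\<open>\<one>\<^sub>N\<close>) where "\<one>\<^sub>N \<equiv> \<one>\<^bsub>grpN \<XX>\<^esub>"
abbreviation d2  (\<open>\<partial>\<^sub>2\<close>) where "\<partial>\<^sub>2 \<equiv> bdy2 \<XX>"
abbreviation d1  (\<open>\<partial>\<^sub>1\<close>) where "\<partial>\<^sub>1 \<equiv> bdy1 \<XX>"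
abbreviation act_on_M  (infixr \<open>\<rhd>\<^sub>M\<close> 75) where "n \<rhd>\<^sub>M m \<equiv> actM \<XX> n m"
abbreviation act_on_L  (infixr \<open>\<rhd>\<^sub>L\<close> 75) where "n \<rhd>\<^sub>L l \<equiv> actL \<XX> n l"
abbreviation act_of_M  (infixr \<open>\<star>\<close> 75) where "m \<star> l \<equiv> actML \<XX> m l"
abbreviation peiffer  (\<open>\<lbrace>_,/ _\<rbrace>\<close>) where "\<lbrace>m, m'\<rbrace> \<equiv> lift \<XX> m m'"

sublocale L: group "grpL \<XX>" by (rule group_L)
sublocale M: group "grpM \<XX>" by (rule group_M)
sublocale N: group "grpN \<XX>" by (rule group_N)
sublocale d2: group_hom "grpL \<XX>" "grpM \<XX>" "\<partial>\<^sub>2"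
  by (intro group_hom.intro group_hom_axioms.intro group_L group_M bdy2_hom)
sublocale d1: group_hom "grpM \<XX>" "grpN \<XX>" "\<partial>\<^sub>1"
  by (intro group_hom.intro group_hom_axioms.intro group_M group_N bdy1_hom)

lemma actM_simps [simp]:
  assumes "n \<in> N"
  shows "m \<in> M \<Longrightarrow> n \<rhd>\<^sub>M m \<in> M"
    and "\<lbrakk>m \<in> M; m' \<in> M\<rbrakk> \<Longrightarrow> n \<rhd>\<^sub>M (m \<cdot>\<^sub>M m') = n \<rhd>\<^sub>M m \<cdot>\<^sub>M n \<rhd>\<^sub>M m'"
    and "n \<rhd>\<^sub>M \<one>\<^sub>M = \<one>\<^sub>M"
    and "m \<in> M \<Longrightarrow> n \<rhd>\<^sub>M (inv\<^sub>M m) = inv\<^sub>M (n \<rhd>\<^sub>M m)"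
    and "\<lbrakk>n' \<in> N; m \<in> M\<rbrakk> \<Longrightarrow> (n \<cdot>\<^sub>N n') \<rhd>\<^sub>M m = n \<rhd>\<^sub>M n' \<rhd>\<^sub>M m"
proof -
  note act = AutoGroup_action[OF group_N group_M actM_hom]
  interpret h: group_hom "grpM \<XX>" "grpM \<XX>" "actM \<XX> n"
    using assms by (rule act) auto
  show "m \<in> M \<Longrightarrow> n \<rhd>\<^sub>M m \<in> M"
    "\<lbrakk>m \<in> M; m' \<in> M\<rbrakk> \<Longrightarrow> n \<rhd>\<^sub>M (m \<cdot>\<^sub>M m') = n \<rhd>\<^sub>M m \<cdot>\<^sub>M n \<rhd>\<^sub>M m'"
    "n \<rhd>\<^sub>M \<one>\<^sub>M = \<one>\<^sub>M" "m \<in> M \<Longrightarrow> n \<rhd>\<^sub>M (inv\<^sub>M m) = inv\<^sub>M (n \<rhd>\<^sub>M m)"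
    by auto
  show "\<lbrakk>n' \<in> N; m \<in> M\<rbrakk> \<Longrightarrow> (n \<cdot>\<^sub>N n') \<rhd>\<^sub>M m = n \<rhd>\<^sub>M n' \<rhd>\<^sub>M m"
    using act(2) assms by blast
qed

lemma one_actM [simp]: "m \<in> M \<Longrightarrow> \<one>\<^sub>N \<rhd>\<^sub>M m = m"
  using AutoGroup_action(3)[OF group_N group_M actM_hom] by blast

lemma actL_simps [simp]:
  assumes "n \<in> N"
  shows "l \<in> L \<Longrightarrow> n \<rhd>\<^sub>L l \<in> L"
    and "\<lbrakk>l \<in> L; l' \<in> L\<rbrakk> \<Longrightarrow> n \<rhd>\<^sub>L (l \<cdot>\<^sub>L l') = n \<rhd>\<^sub>L l \<cdot>\<^sub>L n \<rhd>\<^sub>L l'"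
    and "n \<rhd>\<^sub>L \<one>\<^sub>L = \<one>\<^sub>L"
    and "l \<in> L \<Longrightarrow> n \<rhd>\<^sub>L (inv\<^sub>L l) = inv\<^sub>L (n \<rhd>\<^sub>L l)"
    and "\<lbrakk>n' \<in> N; l \<in> L\<rbrakk> \<Longrightarrow> (n \<cdot>\<^sub>N n') \<rhd>\<^sub>L l = n \<rhd>\<^sub>L n' \<rhd>\<^sub>L l"
proof -
  note act = AutoGroup_action[OF group_N group_L actL_hom]
  interpret h: group_hom "grpL \<XX>" "grpL \<XX>" "actL \<XX> n"
    using assms by (rule act) auto
  show "l \<in> L \<Longrightarrow> n \<rhd>\<^sub>L l \<in> L"
    "\<lbrakk>l \<in> L; l' \<in> L\<rbrakk> \<Longrightarrow> n \<rhd>\<^sub>L (l \<cdot>\<^sub>L l') = n \<rhd>\<^sub>L l \<cdot>\<^sub>L n \<rhd>\<^sub>L l'"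
    "n \<rhd>\<^sub>L \<one>\<^sub>L = \<one>\<^sub>L" "l \<in> L \<Longrightarrow> n \<rhd>\<^sub>L (inv\<^sub>L l) = inv\<^sub>L (n \<rhd>\<^sub>L l)"
    by auto
  show "\<lbrakk>n' \<in> N; l \<in> L\<rbrakk> \<Longrightarrow> (n \<cdot>\<^sub>N n') \<rhd>\<^sub>L l = n \<rhd>\<^sub>L n' \<rhd>\<^sub>L l"
    using act(2) assms by blast
qed

lemma one_actL [simp]: "l \<in> L \<Longrightarrow> \<one>\<^sub>N \<rhd>\<^sub>L l = l"
  using AutoGroup_action(3)[OF group_N group_L actL_hom] by blast

lemmas [simp] = bdy1_bdy2 bdy2_equivariant bdy1_equivariant lift_closed L.inv_mult_group
  M.inv_mult_group N.inv_mult_group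
lemmas group_assoc = L.m_assoc M.m_assoc N.m_assoc

lemma star_closed [simp]: "\<lbrakk>m \<in> M; l \<in> L\<rbrakk> \<Longrightarrow> m \<star> l \<in> L"
  by (simp add: actML_def)

lemma lift_d2_left: "\<lbrakk>l \<in> L; m \<in> M\<rbrakk> \<Longrightarrow> \<lbrace>\<partial>\<^sub>2 l, m\<rbrace> = m \<star> l \<cdot>\<^sub>L inv\<^sub>L l"
  by (simp add: actML_def group_assoc)

text \<open>The fourth axiom, solved for its first factor.\<close>

lemma lift_d2_right: "\<lbrakk>l \<in> L; m \<in> M\<rbrakk> \<Longrightarrow> \<lbrace>m, \<partial>\<^sub>2 l\<rbrace> = \<partial>\<^sub>1 m \<rhd>\<^sub>L l \<cdot>\<^sub>L inv\<^sub>L (m \<star> l)"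
  using CM4[of m l] L.inv_solve_right'[of "\<lbrace>m, \<partial>\<^sub>2 l\<rbrace>" "\<partial>\<^sub>1 m \<rhd>\<^sub>L l \<cdot>\<^sub>L inv\<^sub>L l" "m \<star> l \<cdot>\<^sub>L inv\<^sub>L l"]
  by (simp add: lift_d2_left group_assoc)

lemma d2_star [simp]:
  assumes "m \<in> M" "l \<in> L"
  shows "\<partial>\<^sub>2 (m \<star> l) = m \<cdot>\<^sub>M \<partial>\<^sub>2 l \<cdot>\<^sub>M inv\<^sub>M m"
  using assms by (simp add: actML_def CM1 group_assoc)

lemma star_d2: "\<lbrakk>l \<in> L; x \<in> L\<rbrakk> \<Longrightarrow> \<partial>\<^sub>2 l \<star> x = l \<cdot>\<^sub>L x \<cdot>\<^sub>L inv\<^sub>L l"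
  by (simp add: actML_def CM2 group_assoc)

lemma one_star [simp]: "l \<in> L \<Longrightarrow> \<one>\<^sub>M \<star> l = l"
  using star_d2[of "\<one>\<^sub>L" l] by simp

lemma star_one [simp]: "m \<in> M \<Longrightarrow> m \<star> \<one>\<^sub>L = \<one>\<^sub>L"
  using CM3_i[of "\<one>\<^sub>M" "\<one>\<^sub>M" m] by (simp add: actML_def L.r_cancel_one')

lemma lift_one_left [simp]: "m \<in> M \<Longrightarrow> \<lbrace>\<one>\<^sub>M, m\<rbrace> = \<one>\<^sub>L"
  using lift_d2_left[of "\<one>\<^sub>L" m] by simp

text \<open>The expansion of a product in the second argument involves the action of
  \<open>m (\<partial>\<^sub>2 l) m\<inverse> = \<partial>\<^sub>2 (m \<star> l)\<close>, which is conjugation by \<open>m \<star> l\<close>.\<close>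

lemma lift_mult_d2_right:
  assumes "m \<in> M" "l \<in> L" "a \<in> M"
  shows "\<lbrace>m, \<partial>\<^sub>2 l \<cdot>\<^sub>M a\<rbrace> = \<partial>\<^sub>1 m \<rhd>\<^sub>L l \<cdot>\<^sub>L \<lbrace>m, a\<rbrace> \<cdot>\<^sub>L inv\<^sub>L (m \<star> l)"
proof -
  have "\<lbrace>m, \<partial>\<^sub>2 l \<cdot>\<^sub>M a\<rbrace> = \<lbrace>m, \<partial>\<^sub>2 l\<rbrace> \<cdot>\<^sub>L \<partial>\<^sub>2 (m \<star> l) \<star> \<lbrace>m, a\<rbrace>"
    using assms by (simp add: CM3_ii)
  then show ?thesis
    using assms by (simp add: star_d2 lift_d2_right group_assoc del: d2_star)
qed

text \<open>That \<open>\<star>\<close> is an action by automorphisms is not an axiom. Expanding \<open>\<lbrace>\<partial>\<^sub>2 (l l'), m\<rbrace>\<close> in its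
  first argument would be circular, since the result again involves \<open>\<star>\<close> applied to products; the
  proofs expand \<open>\<lbrace>m, \<partial>\<^sub>2 l\<rbrace>\<close> instead, which determines \<open>m \<star> l\<close> by \<open>lift_d2_right\<close>.\<close>

lemma star_mult [simp]:
  assumes "m \<in> M" "l \<in> L" "l' \<in> L"
  shows "m \<star> (l \<cdot>\<^sub>L l') = m \<star> l \<cdot>\<^sub>L m \<star> l'"
proof -
  have "\<lbrace>m, \<partial>\<^sub>2 (l \<cdot>\<^sub>L l')\<rbrace> = \<partial>\<^sub>1 m \<rhd>\<^sub>L l \<cdot>\<^sub>L \<lbrace>m, \<partial>\<^sub>2 l'\<rbrace> \<cdot>\<^sub>L inv\<^sub>L (m \<star> l)"
    using assms by (simp add: lift_mult_d2_right)
  then have "inv\<^sub>L (m \<star> (l \<cdot>\<^sub>L l')) = inv\<^sub>L (m \<star> l') \<cdot>\<^sub>L inv\<^sub>L (m \<star> l)"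
    using assms by (simp add: lift_d2_right group_assoc del: d2.hom_mult)
  then show ?thesis
    using assms by (metis L.inv_inv L.inv_mult_group L.m_closed star_closed)
qed

lemma star_star [simp]:
  assumes "m \<in> M" "m' \<in> M" "l \<in> L"
  shows "(m \<cdot>\<^sub>M m') \<star> l = m \<star> m' \<star> l"
proof -
  have "\<lbrace>m \<cdot>\<^sub>M m', \<partial>\<^sub>2 l\<rbrace> = \<partial>\<^sub>1 m \<rhd>\<^sub>L \<lbrace>m', \<partial>\<^sub>2 l\<rbrace> \<cdot>\<^sub>L \<lbrace>m, \<partial>\<^sub>2 (m' \<star> l)\<rbrace>"
    using assms by (simp add: CM3_i)
  then have "inv\<^sub>L ((m \<cdot>\<^sub>M m') \<star> l) = inv\<^sub>L (m \<star> m' \<star> l)"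
    using assms by (simp add: lift_d2_right group_assoc del: d2_star)
  then show ?thesis
    using assms by (metis L.inv_inv M.m_closed star_closed)
qed

lemma act_star [simp]:
  assumes "n \<in> N" "m \<in> M" "l \<in> L"
  shows "n \<rhd>\<^sub>L (m \<star> l) = (n \<rhd>\<^sub>M m) \<star> (n \<rhd>\<^sub>L l)"
  using assms by (simp add: actML_def CM5)

subsection \<open>The groups of cells\<close>

lemma cells_simps [simp]:
  "carrier (cells3 \<XX>) = L \<times> M \<times> N"
  "carrier (cells2 \<XX>) = {\<one>\<^sub>L} \<times> M \<times> N"
  "carrier (cells1 \<XX>) = {\<one>\<^sub>L} \<times> {\<one>\<^sub>M} \<times> N"
  "(l, m, n) \<otimes>\<^bsub>cells3 \<XX>\<^esub> (l', m', n') = (l \<cdot>\<^sub>L m \<star> n \<rhd>\<^sub>L l', m \<cdot>\<^sub>M n \<rhd>\<^sub>M m', n \<cdot>\<^sub>N n')"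
  "mult (cells2 \<XX>) = mult (cells3 \<XX>)"
  "mult (cells1 \<XX>) = mult (cells3 \<XX>)"
  "\<one>\<^bsub>cells3 \<XX>\<^esub> = (\<one>\<^sub>L, \<one>\<^sub>M, \<one>\<^sub>N)"
  "\<one>\<^bsub>cells2 \<XX>\<^esub> = (\<one>\<^sub>L, \<one>\<^sub>M, \<one>\<^sub>N)"
  "\<one>\<^bsub>cells1 \<XX>\<^esub> = (\<one>\<^sub>L, \<one>\<^sub>M, \<one>\<^sub>N)"
  by (simp_all add: cells3_def cells2_def cells1_def)

lemma group_cells3: "group (cells3 \<XX>)"
proof (rule groupI)
  fix x assume "x \<in> carrier (cells3 \<XX>)"
  then obtain l m n where x: "x = (l, m, n)" "l \<in> L" "m \<in> M" "n \<in> N" by auto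
  let ?m' = "inv\<^sub>N n \<rhd>\<^sub>M inv\<^sub>M m"
  show "\<exists>y\<in>carrier (cells3 \<XX>). y \<otimes>\<^bsub>cells3 \<XX>\<^esub> x = \<one>\<^bsub>cells3 \<XX>\<^esub>"
    by (rule bexI[of _ "(inv\<^sub>L (?m' \<star> inv\<^sub>N n \<rhd>\<^sub>L l), ?m', inv\<^sub>N n)"]) (use x in auto)
qed (auto simp: group_assoc)

lemma source3_hom: "(\<lambda>(l, m, n). (\<one>\<^sub>L, m, n)) \<in> hom (cells3 \<XX>) (cells2 \<XX>)"
  and target3_hom: "(\<lambda>(l, m, n). (\<one>\<^sub>L, \<partial>\<^sub>2 l \<cdot>\<^sub>M m, n)) \<in> hom (cells3 \<XX>) (cells2 \<XX>)"
  by (auto simp: hom_def group_assoc)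

text \<open>The cells of lower dimension are subgroups of \<^term>\<open>cells3 \<XX>\<close>, being images of
  endomorphisms.\<close>

lemma group_cells2: "group (cells2 \<XX>)"
  and group_cells1: "group (cells1 \<XX>)"
proof -
  interpret group "cells3 \<XX>" by (rule group_cells3)
  interpret s3: group_hom "cells3 \<XX>" "cells3 \<XX>" "\<lambda>(l, m, n). (\<one>\<^sub>L, m, n)"
    by unfold_locales (auto simp: hom_def)
  interpret s2: group_hom "cells3 \<XX>" "cells3 \<XX>" "\<lambda>(l, m, n). (\<one>\<^sub>L, \<one>\<^sub>M, n)"
    by unfold_locales (auto simp: hom_def)
  have "(\<lambda>(l, m, n). (\<one>\<^sub>L, m, n)) ` (L \<times> M \<times> N) = {\<one>\<^sub>L} \<times> M \<times> N"
    "(\<lambda>(l, m, n). (\<one>\<^sub>L, \<one>\<^sub>M, n)) ` (L \<times> M \<times> N) = {\<one>\<^sub>L} \<times> {\<one>\<^sub>M} \<times> N"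
    by (force simp: image_iff)+
  then show "group (cells2 \<XX>)" "group (cells1 \<XX>)"
    using subgroup.subgroup_is_group[OF s3.img_is_subgroup group_cells3]
      subgroup.subgroup_is_group[OF s2.img_is_subgroup group_cells3]
    by (simp_all add: cells2_def cells1_def)
qed

section \<open>Relations between cells\<close>

text \<open>Representatives of \<^const>\<open>v11\<close> and \<^const>\<open>v22\<close>.\<close>

definition gen2 :: "'m \<Rightarrow> 'n \<Rightarrow> ('l, 'm, 'n, 'k::field) vec" where
  "gen2 m n = \<e> (\<one>\<^sub>L, m, n) - \<e> (\<one>\<^sub>L, \<one>\<^sub>M, n)"

definition gen3 :: "'l \<Rightarrow> 'm \<Rightarrow> 'n \<Rightarrow> ('l, 'm, 'n, 'k::field) vec" where
  "gen3 l m n = \<e> (l, m, n) - \<e> (\<one>\<^sub>L, m, n)"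

text \<open>The 3-cells \<open>(l, 1, n)\<close> start at the identity 2-cell of \<open>n\<close>. Modulo \<open>J2\<close> they suffice
  (lemma \<open>kills_J2_gen3\<close>).\<close>

definition loop3 :: "'l \<Rightarrow> 'n \<Rightarrow> ('l, 'm, 'n, 'k::field) vec" where
  "loop3 l n = gen3 l \<one>\<^sub>M n"

lemma gen_one [simp]: "gen2 \<one>\<^sub>M n = 0" "gen3 \<one>\<^sub>L m n = 0" "loop3 \<one>\<^sub>L n = 0"
  by (simp_all add: gen2_def gen3_def loop3_def)

lemma vert2_rewrite:
  assumes F: "lin F" "\<And>r. r \<in> relators_vert2 \<XX> \<Longrightarrow> F r = 0"
    and "m \<in> M" "m' \<in> M" "n \<in> N"
  shows "F (\<e> (\<one>\<^sub>L, m' \<cdot>\<^sub>M m, n)) =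
    F (\<e> (\<one>\<^sub>L, m, n)) + F (\<e> (\<one>\<^sub>L, m', \<partial>\<^sub>1 m \<cdot>\<^sub>N n)) - F (\<e> (\<one>\<^sub>L, \<one>\<^sub>M, \<partial>\<^sub>1 m \<cdot>\<^sub>N n))"
proof -
  have "F (\<e> (\<one>\<^sub>L, m' \<cdot>\<^sub>M m, n) - \<e> (\<one>\<^sub>L, m, n) - \<e> (\<one>\<^sub>L, m', \<partial>\<^sub>1 m \<cdot>\<^sub>N n) +
      \<e> (\<one>\<^sub>L, \<one>\<^sub>M, \<partial>\<^sub>1 m \<cdot>\<^sub>N n)) = 0"
    by (rule F(2)) (use assms(3-) in \<open>auto simp: relators_vert2_def\<close>)
  then show ?thesis
    by (simp add: lin_simps[OF F(1)] algebra_simps)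
qed

lemma keys_relators_vert2: "r \<in> relators_vert2 \<XX> \<Longrightarrow> Poly_Mapping.keys r \<subseteq> {\<one>\<^sub>L} \<times> M \<times> N"
  by (auto simp: relators_vert2_def keys_subset_iff_span
      intro!: fs.span_add fs.span_diff fs.span_base[OF imageI])

text \<open>A left or right multiple of a relator is evaluated under a linear map with kernel the span.
  Splitting every product of 2-cells by \<open>vert2_rewrite\<close> makes all terms cancel, by equivariance of
  \<open>\<partial>\<^sub>1\<close>.\<close>

lemma ideal_span_vert2:
  "ideal (fs.span (relators_vert2 \<XX>) :: ('l, 'm, 'n, 'k::field) vec set) (group_algebra (cells2 \<XX>))"
proof -
  obtain F :: "('l, 'm, 'n, 'k) vec \<Rightarrow> ('l, 'm, 'n, 'k) vec"
    where F: "lin F" "\<And>x. F x = 0 \<longleftrightarrow> x \<in> fs.span (relators_vert2 \<XX>)"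
    by (rule subspace_is_kernel[OF fs.subspace_span[of "relators_vert2 \<XX>"]]) blast
  have F0: "F r = 0" if "r \<in> relators_vert2 \<XX>" for r using that F(2) by (blast intro: fs.span_base)
  note rw = vert2_rewrite[OF F(1) F0] lin_simps[OF F(1)] lin_simps[OF lin_alg_mult_left]
    lin_simps[OF lin_alg_mult_right]
  show ?thesis
  proof (rule ideal_spanI[OF group_cells2])
    fix g and r :: "('l, 'm, 'n, 'k) vec"
    assume "g \<in> carrier (cells2 \<XX>)"
    then obtain a p where g: "g = (\<one>\<^sub>L, a, p)" "a \<in> M" "p \<in> N" by auto
    assume "r \<in> relators_vert2 \<XX>"
    then obtain m m' n where r: "r = \<e> (\<one>\<^sub>L, m' \<cdot>\<^sub>M m, n) - \<e> (\<one>\<^sub>L, m, n)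
        - \<e> (\<one>\<^sub>L, m', \<partial>\<^sub>1 m \<cdot>\<^sub>N n) + \<e> (\<one>\<^sub>L, \<one>\<^sub>M, \<partial>\<^sub>1 m \<cdot>\<^sub>N n)" "m \<in> M" "m' \<in> M" "n \<in> N"
      unfolding relators_vert2_def by blast
    show "alg_mult (cells2 \<XX>) (\<e> g) r \<in> fs.span (relators_vert2 \<XX>)"
      "alg_mult (cells2 \<XX>) r (\<e> g) \<in> fs.span (relators_vert2 \<XX>)"
      unfolding F(2)[symmetric] using g r by (simp_all add: rw group_assoc)
  qed (simp add: keys_relators_vert2)
qed

lemma J1_span: "J1 \<XX> = fs.span (relators_vert2 \<XX>)"
proof -
  interpret A: ring "group_algebra (cells2 \<XX>)" by (rule ring_group_algebra[OF group_cells2])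
  have R: "relators_vert2 \<XX> \<subseteq> carrier (group_algebra (cells2 \<XX>))"
    by (intro subsetI) (simp add: keys_relators_vert2)
  show ?thesis unfolding J1_def
  proof
    show "genideal (group_algebra (cells2 \<XX>)) (relators_vert2 \<XX>) \<subseteq> fs.span (relators_vert2 \<XX>)"
      by (rule A.genideal_minimal[OF ideal_span_vert2]) (auto intro: fs.span_base)
    show "fs.span (relators_vert2 \<XX>) \<subseteq> genideal (group_algebra (cells2 \<XX>)) (relators_vert2 \<XX>)"
      by (rule fs.span_minimal[OF A.genideal_self[OF R]])
        (rule ideal_group_algebra_subspace[OF group_cells2 A.genideal_ideal[OF R]])
  qed
qed

lemma relators2_J1: "r \<in> relators_vert2 \<XX> \<Longrightarrow> r \<in> J1 \<XX>"
  by (simp add: J1_span fs.span_base)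

lemma subspace_J1: "fs.subspace (J1 \<XX>)"
  by (simp add: J1_span)

lemma ideal_J1: "ideal (J1 \<XX>) (group_algebra (cells2 \<XX>))"
  by (simp only: J1_span ideal_span_vert2)

abbreviation relators3 :: "('l, 'm, 'n, 'k::field) vec set" where
  "relators3 \<equiv> relators_2vert3 \<XX> \<union> relators_1vert3 \<XX> \<union> relators_vert2 \<XX>"

lemma relators3_carrier: "relators3 \<subseteq> carrier (group_algebra (cells3 \<XX>))"
  by (auto simp: relators_2vert3_def relators_1vert3_def relators_vert2_def keys_subset_iff_span
    simp del: Un_iff intro!: fs.span_add fs.span_diff fs.span_base[OF imageI])

lemma ideal_J2: "ideal (J2 \<XX>) (group_algebra (cells3 \<XX>))"
  and relators3_J2: "r \<in> relators3 \<Longrightarrow> r \<in> J2 \<XX>"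
  unfolding J2_def
  using ring.genideal_ideal[OF ring_group_algebra[OF group_cells3] relators3_carrier]
    ring.genideal_self[OF ring_group_algebra[OF group_cells3] relators3_carrier]
  by blast+

lemma subspace_J2: "fs.subspace (J2 \<XX>)"
  by (rule ideal_group_algebra_subspace[OF group_cells3 ideal_J2])

text \<open>\<open>J1\<close> is an ideal of a subalgebra only, but it is spanned by elements of \<open>J2\<close>.\<close>

lemma J1_subset_J2: "x \<in> J1 \<XX> \<Longrightarrow> x \<in> J2 \<XX>"
  unfolding J1_span using fs.span_minimal[OF _ subspace_J2, of "relators_vert2 \<XX>"] relators3_J2 by blast

definition kills :: "(('l, 'm, 'n, 'k) vec \<Rightarrow> ('l, 'm, 'n, 'k) vec) \<Rightarrow> ('l, 'm, 'n, 'k::field) vec set \<Rightarrow> bool" where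
  "kills F J \<longleftrightarrow> lin F \<and> (\<forall>x\<in>J. F x = 0)"

lemma mem_if_killed:
  assumes "fs.subspace J" "\<And>F. kills F J \<Longrightarrow> F x = 0"
  shows "x \<in> J"
  by (rule subspace_is_kernel[OF assms(1)]) (use assms(2) in \<open>auto simp: kills_def\<close>)

lemma kills_lin: "kills F J \<Longrightarrow> lin F"
  by (simp add: kills_def)

lemma kills_relator:
  "\<lbrakk>kills F (J1 \<XX>); r \<in> relators_vert2 \<XX>\<rbrakk> \<Longrightarrow> F r = 0"
  "\<lbrakk>kills F (J2 \<XX>); r \<in> relators_vert2 \<XX>\<rbrakk> \<Longrightarrow> F r = 0"
  "\<lbrakk>kills F (J2 \<XX>); r \<in> relators_1vert3 \<XX>\<rbrakk> \<Longrightarrow> F r = 0"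
  "\<lbrakk>kills F (J2 \<XX>); r \<in> relators_2vert3 \<XX>\<rbrakk> \<Longrightarrow> F r = 0"
  using relators2_J1[of r] relators3_J2[of r] by (simp_all add: kills_def)

lemma kills_J1_gen2_mult:
  assumes "kills F (J1 \<XX>)" and "m \<in> M" "m' \<in> M" "n \<in> N"
  shows "F (gen2 (m' \<cdot>\<^sub>M m) n) = F (gen2 m n) + F (gen2 m' (\<partial>\<^sub>1 m \<cdot>\<^sub>N n))"
  using vert2_rewrite[OF kills_lin[OF assms(1)] kills_relator(1)[OF assms(1)] assms(2-)]
  by (simp add: gen2_def lin_simps[OF kills_lin[OF assms(1)]])

lemma kills_J1_gen2_inv:
  assumes "kills F (J1 \<XX>)" and "m \<in> M" "n \<in> N"
  shows "F (gen2 (inv\<^sub>M m) n) = - F (gen2 m (\<partial>\<^sub>1 (inv\<^sub>M m) \<cdot>\<^sub>N n))"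
  using kills_J1_gen2_mult[OF assms(1), of "inv\<^sub>M m" m n] assms(2,3)
  by (simp add: lin_simps[OF kills_lin[OF assms(1)]] eq_neg_iff_add_eq_0 add.commute)

lemma kills_J2_vertical1:
  assumes F: "kills F (J2 \<XX>)" and "l \<in> L" "l' \<in> L" "m \<in> M" "m' \<in> M" "n \<in> N"
  shows "F (gen3 (l' \<cdot>\<^sub>L m' \<star> l) (m' \<cdot>\<^sub>M m) n) = F (gen3 l m n) + F (gen3 l' m' (\<partial>\<^sub>1 m \<cdot>\<^sub>N n))"
proof -
  let ?n = "\<partial>\<^sub>1 m \<cdot>\<^sub>N n"
  note lins = lin_simps[OF kills_lin[OF F]]
  have 1: "F (\<e> (l' \<cdot>\<^sub>L m' \<star> l, m' \<cdot>\<^sub>M m, n) - \<e> (l, m, n) - \<e> (l', m', ?n) + \<e> (\<one>\<^sub>L, \<one>\<^sub>M, ?n)) = 0"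
    by (rule kills_relator(3)[OF F]) (use assms(2-) in \<open>unfold relators_1vert3_def, blast\<close>)
  have 2: "F (\<e> (\<one>\<^sub>L, m' \<cdot>\<^sub>M m, n)) = F (\<e> (\<one>\<^sub>L, m, n)) + F (\<e> (\<one>\<^sub>L, m', ?n)) - F (\<e> (\<one>\<^sub>L, \<one>\<^sub>M, ?n))"
    by (rule vert2_rewrite[OF kills_lin[OF F] kills_relator(2)[OF F] assms(4-)])
  show ?thesis
    using 1 by (simp add: gen3_def lins 2 algebra_simps)
qed

lemma kills_J2_vertical2:
  assumes F: "kills F (J2 \<XX>)" and "l \<in> L" "l' \<in> L" "m \<in> M" "n \<in> N"
  shows "F (gen3 (l' \<cdot>\<^sub>L l) m n) = F (gen3 l m n) + F (gen3 l' (\<partial>\<^sub>2 l \<cdot>\<^sub>M m) n)"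
proof -
  have "F (\<e> (l' \<cdot>\<^sub>L l, m, n) - \<e> (l, m, n) - \<e> (l', \<partial>\<^sub>2 l \<cdot>\<^sub>M m, n) + \<e> (\<one>\<^sub>L, \<partial>\<^sub>2 l \<cdot>\<^sub>M m, n)) = 0"
    by (rule kills_relator(4)[OF F]) (use assms(2-) in \<open>unfold relators_2vert3_def, blast\<close>)
  then show ?thesis
    by (simp add: gen3_def lin_simps[OF kills_lin[OF F]] algebra_simps)
qed

text \<open>The 3-cell \<open>(l, m, n)\<close> is the 1-vertical composite of \<open>(l, 1, \<partial>\<^sub>1 m n)\<close> with the identity
  3-cell of \<open>(m, n)\<close>.\<close>

lemma kills_J2_gen3:
  assumes F: "kills F (J2 \<XX>)" and "l \<in> L" "m \<in> M" "n \<in> N"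
  shows "F (gen3 l m n) = F (loop3 l (\<partial>\<^sub>1 m \<cdot>\<^sub>N n))"
  using kills_J2_vertical1[OF F, of "\<one>\<^sub>L" l m "\<one>\<^sub>M" n] assms(2-)
  by (simp add: loop3_def lin_simps[OF kills_lin[OF F]])

text \<open>The 2-vertical relation shifts the second summand by \<open>\<partial>\<^sub>1 (\<partial>\<^sub>2 l)\<close>, which is trivial.\<close>

lemma kills_J2_loop3_mult:
  assumes F: "kills F (J2 \<XX>)" and "l \<in> L" "l' \<in> L" "n \<in> N"
  shows "F (loop3 (l' \<cdot>\<^sub>L l) n) = F (loop3 l n) + F (loop3 l' n)"
  using kills_J2_vertical2[OF F, of l l' "\<one>\<^sub>M" n] assms(2-)
  by (simp add: loop3_def[symmetric] kills_J2_gen3[OF F])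

lemma kills_J2_loop3_inv:
  assumes F: "kills F (J2 \<XX>)" and "l \<in> L" "n \<in> N"
  shows "F (loop3 (inv\<^sub>L l) n) = - F (loop3 l n)"
  using kills_J2_loop3_mult[OF F, of l "inv\<^sub>L l" n] assms(2-)
  by (simp add: lin_simps[OF kills_lin[OF F]] eq_neg_iff_add_eq_0 add.commute)

text \<open>The rule is oriented so as to remove \<open>\<star>\<close>.\<close>

lemma kills_J2_loop3_star:
  assumes F: "kills F (J2 \<XX>)" and "l \<in> L" "m \<in> M" "n \<in> N"
  shows "F (loop3 (m \<star> l) n) = F (loop3 l (\<partial>\<^sub>1 (inv\<^sub>M m) \<cdot>\<^sub>N n))"
  using kills_J2_vertical1[OF F, of l "\<one>\<^sub>L" "inv\<^sub>M m" m n] assms(2-)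
  by (simp add: loop3_def[symmetric] kills_J2_gen3[OF F] lin_simps[OF kills_lin[OF F]])

text \<open>Used from left to right, these rules bring the value of a linear map killing \<open>J1\<close> or \<open>J2\<close>
  to a sum of values on \<open>gen2\<close> and \<open>loop3\<close> with indecomposable arguments.\<close>

lemmas J1_rules = lin_simps[OF kills_lin] kills_J1_gen2_mult kills_J1_gen2_inv
lemmas J2_rules = lin_simps[OF kills_lin] kills_J2_gen3 kills_J2_loop3_mult kills_J2_loop3_inv kills_J2_loop3_star

section \<open>The regular representation on representatives\<close>

text \<open>The map \<open>shift\<close> serves in all three degrees, since it leaves \<open>l\<close> and \<open>m\<close> alone.\<close>

definition shift :: "'n \<Rightarrow> ('l, 'm, 'n, 'k::field) vec \<Rightarrow> ('l, 'm, 'n, 'k) vec" where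
  "shift k = basis_map (\<lambda>(l, m, n). (l, m, n \<cdot>\<^sub>N k))"

definition rep' :: "'m \<Rightarrow> 'n \<Rightarrow> ('l, 'm, 'n, 'k::field) vec \<Rightarrow> ('l, 'm, 'n, 'k) vec" where
  "rep' m k = lin_ext (\<lambda>(_, _, n). gen2 (n \<rhd>\<^sub>M m) (n \<cdot>\<^sub>N k))"

definition rep'' :: "'m \<Rightarrow> 'n \<Rightarrow> ('l, 'm, 'n, 'k::field) vec \<Rightarrow> ('l, 'm, 'n, 'k) vec" where
  "rep'' m k = lin_ext (\<lambda>(_, p, n). gen3 \<lbrace>p, n \<rhd>\<^sub>M m\<rbrace> (p \<cdot>\<^sub>M n \<rhd>\<^sub>M m) (n \<cdot>\<^sub>N k))"

definition rep_alpha :: "'l \<Rightarrow> 'm \<Rightarrow> 'n \<Rightarrow> ('l, 'm, 'n, 'k::field) vec \<Rightarrow> ('l, 'm, 'n, 'k) vec" where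
  "rep_alpha l m k = lin_ext (\<lambda>(_, _, n). gen3 (n \<rhd>\<^sub>L l) (n \<rhd>\<^sub>M m) (n \<cdot>\<^sub>N k))"

lemma lin_maps [simp]: "lin (shift k)" "lin (rep' m k)" "lin (rep'' m k)" "lin (rep_alpha l m k)"
  "lin (sigma3 \<XX>)" "lin (tau3 \<XX>)" "lin (sigma2 \<XX>)" "lin (tau2 \<XX>)"
  by (simp_all add: shift_def rep'_def rep''_def rep_alpha_def sigma3_def tau3_def sigma2_def tau2_def)

lemmas maps_lin_simps = lin_maps[THEN lin_add] lin_maps[THEN lin_scale] lin_maps[THEN lin_diff]
  lin_maps[THEN lin_zero]

lemma maps_basis [simp]:
  "shift k (\<e> (l, m, n)) = \<e> (l, m, n \<cdot>\<^sub>N k)"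
  "rep' m' k (\<e> (l, m, n)) = gen2 (n \<rhd>\<^sub>M m') (n \<cdot>\<^sub>N k)"
  "rep'' m' k (\<e> (l, m, n)) = gen3 \<lbrace>m, n \<rhd>\<^sub>M m'\<rbrace> (m \<cdot>\<^sub>M n \<rhd>\<^sub>M m') (n \<cdot>\<^sub>N k)"
  "rep_alpha l' m' k (\<e> (l, m, n)) = gen3 (n \<rhd>\<^sub>L l') (n \<rhd>\<^sub>M m') (n \<cdot>\<^sub>N k)"
  "sigma3 \<XX> (\<e> (l, m, n)) = \<e> (\<one>\<^sub>L, m, n)"
  "tau3 \<XX> (\<e> (l, m, n)) = \<e> (\<one>\<^sub>L, \<partial>\<^sub>2 l \<cdot>\<^sub>M m, n)"
  "sigma2 \<XX> (\<e> (l, m, n)) = \<e> (\<one>\<^sub>L, \<one>\<^sub>M, n)"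
  "tau2 \<XX> (\<e> (l, m, n)) = \<e> (\<one>\<^sub>L, \<one>\<^sub>M, \<partial>\<^sub>1 m \<cdot>\<^sub>N n)"
  by (simp_all add: shift_def rep'_def rep''_def rep_alpha_def sigma3_def tau3_def sigma2_def tau2_def)

lemma maps_gen [simp]:
  "shift k (gen2 m n) = gen2 m (n \<cdot>\<^sub>N k)"
  "shift k (gen3 l m n) = gen3 l m (n \<cdot>\<^sub>N k)"
  "sigma2 \<XX> (gen2 m n) = 0"
  "sigma3 \<XX> (gen3 l m n) = 0"
  "\<lbrakk>m \<in> M; n \<in> N\<rbrakk> \<Longrightarrow> tau2 \<XX> (gen2 m n) = \<e> (\<one>\<^sub>L, \<one>\<^sub>M, \<partial>\<^sub>1 m \<cdot>\<^sub>N n) - \<e> (\<one>\<^sub>L, \<one>\<^sub>M, n)"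
  "m \<in> M \<Longrightarrow> tau3 \<XX> (gen3 l m n) = gen2 (\<partial>\<^sub>2 l \<cdot>\<^sub>M m) n - gen2 m n"
  "\<lbrakk>p \<in> M; n \<in> N; m \<in> M\<rbrakk> \<Longrightarrow>
    rep'' m k (gen2 p n) = gen3 \<lbrace>p, n \<rhd>\<^sub>M m\<rbrace> (p \<cdot>\<^sub>M n \<rhd>\<^sub>M m) (n \<cdot>\<^sub>N k)"
  by (simp_all add: gen2_def gen3_def maps_lin_simps)

lemma sigma2_tau2_J1:
  fixes x :: "('l, 'm, 'n, 'k::field) vec"
  assumes "x \<in> J1 \<XX>"
  shows "sigma2 \<XX> x = 0" "tau2 \<XX> x = 0"
proof -
  have "sigma2 \<XX> r \<in> {0} \<and> tau2 \<XX> r \<in> {0}" if "r \<in> relators_vert2 \<XX>"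
    for r :: "('l, 'm, 'n, 'k) vec"
    using that unfolding relators_vert2_def
    by (elim CollectE exE conjE) (simp add: maps_lin_simps group_assoc)
  then have "sigma2 \<XX> x \<in> {0}" "tau2 \<XX> x \<in> {0}"
    using assms lin_map_span[OF lin_maps(7) fs.subspace_single_0, of "relators_vert2 \<XX>" x]
      lin_map_span[OF lin_maps(8) fs.subspace_single_0, of "relators_vert2 \<XX>" x]
    unfolding J1_span by blast+
  then show "sigma2 \<XX> x = 0" "tau2 \<XX> x = 0" by auto
qed

lemma sigma3_tau3_J2:
  fixes x :: "('l, 'm, 'n, 'k::field) vec"
  assumes "x \<in> J2 \<XX>"
  shows "sigma3 \<XX> x \<in> J1 \<XX>" "tau3 \<XX> x \<in> J1 \<XX>"
proof -
  have killed: "F (sigma3 \<XX> r) = 0 \<and> F (tau3 \<XX> r) = 0" if F: "kills F (J1 \<XX>)" and r: "r \<in> relators3"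
    for F :: "('l, 'm, 'n, 'k) vec \<Rightarrow> ('l, 'm, 'n, 'k) vec" and r
  proof -
    note rw = maps_lin_simps lin_simps[OF kills_lin[OF F]]
      vert2_rewrite[OF kills_lin[OF F] kills_relator(1)[OF F]] group_assoc
    show ?thesis
      using r unfolding relators_2vert3_def relators_1vert3_def relators_vert2_def
      by (elim UnE CollectE exE conjE) (simp_all add: rw)
  qed
  have maps: "sigma3 \<XX> r \<in> J1 \<XX>" "tau3 \<XX> r \<in> J1 \<XX>"
    if "r \<in> relators3" for r :: "('l, 'm, 'n, 'k) vec"
    using killed[OF _ that] by (auto intro!: mem_if_killed[OF subspace_J1])
  show "sigma3 \<XX> x \<in> J1 \<XX>"
    by (rule genideal_group_algebra_mono[OF _ ideal_J1 relators3_carrier maps(1) assms[unfolded J2_def]])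
      (unfold sigma3_def, intro ring_hom_basis_map group_cells3 group_cells2 source3_hom)
  show "tau3 \<XX> x \<in> J1 \<XX>"
    by (rule genideal_group_algebra_mono[OF _ ideal_J1 relators3_carrier maps(2) assms[unfolded J2_def]])
      (unfold tau3_def, intro ring_hom_basis_map group_cells3 group_cells2 target3_hom)
qed

text \<open>\<open>shift k\<close> is right multiplication by the 1-cell \<open>k\<close>, so it preserves ideals.\<close>

lemma shift_alg_mult:
  assumes "k \<in> N"
  shows "Poly_Mapping.keys x \<subseteq> carrier (cells2 \<XX>) \<Longrightarrow> shift k x = alg_mult (cells2 \<XX>) x (\<e> (\<one>\<^sub>L, \<one>\<^sub>M, k))"
    and "Poly_Mapping.keys x \<subseteq> carrier (cells3 \<XX>) \<Longrightarrow> shift k x = alg_mult (cells3 \<XX>) x (\<e> (\<one>\<^sub>L, \<one>\<^sub>M, k))"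
  by (rule lin_eq_keys[where f = x], (simp add: lin_alg_mult_left)+, use assms in auto)+

lemma shift_J:
  assumes "k \<in> N"
  shows "x \<in> J1 \<XX> \<Longrightarrow> shift k x \<in> J1 \<XX>" and "x \<in> J2 \<XX> \<Longrightarrow> shift k x \<in> J2 \<XX>"
proof -
  interpret I1: ideal "J1 \<XX>" "group_algebra (cells2 \<XX>)" by (rule ideal_J1)
  interpret I2: ideal "J2 \<XX>" "group_algebra (cells3 \<XX>)" by (rule ideal_J2)
  show "x \<in> J1 \<XX> \<Longrightarrow> shift k x \<in> J1 \<XX>"
    using I1.Icarr[of x] I1.I_r_closed[of x "\<e> (\<one>\<^sub>L, \<one>\<^sub>M, k)"] shift_alg_mult(1)[OF assms, of x] assms
    by simp
  show "x \<in> J2 \<XX> \<Longrightarrow> shift k x \<in> J2 \<XX>"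
    using I2.Icarr[of x] I2.I_r_closed[of x "\<e> (\<one>\<^sub>L, \<one>\<^sub>M, k)"] shift_alg_mult(2)[OF assms, of x] assms
    by simp
qed

subsection \<open>Identities on generators\<close>

text \<open>This is what makes \<open>\<lambda>''\<close> well defined. For the relator of \<open>p'\<close> and \<open>p\<close> the expansion of
  \<open>\<lbrace>p' p, a\<rbrace>\<close> contains \<open>\<lbrace>p', p a p\<inverse>\<rbrace>\<close>, whereas the relator contributes \<open>\<lbrace>p', \<partial>\<^sub>1 p \<rhd>\<^sub>M a\<rbrace>\<close>. The two
  second arguments differ by the boundary of \<open>\<lbrace>p, a\<rbrace>\<close>.\<close>

lemma rep''_J1_J2:
  assumes "m \<in> M" "k \<in> N" "x \<in> J1 \<XX>"
  shows "rep'' m k x \<in> J2 \<XX>"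
proof (rule lin_map_span[OF lin_maps(3) subspace_J2 _ assms(3)[unfolded J1_span]],
    rule mem_if_killed[OF subspace_J2])
  fix r :: "('l, 'm, 'n, 'k::field) vec" and F :: "('l, 'm, 'n, 'k) vec \<Rightarrow> ('l, 'm, 'n, 'k) vec"
  assume F: "kills F (J2 \<XX>)"
  assume "r \<in> relators_vert2 \<XX>"
  then obtain p p' n where r: "r = \<e> (\<one>\<^sub>L, p' \<cdot>\<^sub>M p, n) - \<e> (\<one>\<^sub>L, p, n)
      - \<e> (\<one>\<^sub>L, p', \<partial>\<^sub>1 p \<cdot>\<^sub>N n) + \<e> (\<one>\<^sub>L, \<one>\<^sub>M, \<partial>\<^sub>1 p \<cdot>\<^sub>N n)" "p \<in> M" "p' \<in> M" "n \<in> N"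
    unfolding relators_vert2_def by blast
  let ?a = "n \<rhd>\<^sub>M m"
  have "\<partial>\<^sub>1 p \<rhd>\<^sub>M ?a = \<partial>\<^sub>2 \<lbrace>p, ?a\<rbrace> \<cdot>\<^sub>M (p \<cdot>\<^sub>M ?a \<cdot>\<^sub>M inv\<^sub>M p)"
    using r assms by (simp add: CM1 group_assoc)
  then have "\<lbrace>p', \<partial>\<^sub>1 p \<rhd>\<^sub>M ?a\<rbrace> =
      \<partial>\<^sub>1 p' \<rhd>\<^sub>L \<lbrace>p, ?a\<rbrace> \<cdot>\<^sub>L \<lbrace>p', p \<cdot>\<^sub>M ?a \<cdot>\<^sub>M inv\<^sub>M p\<rbrace> \<cdot>\<^sub>L inv\<^sub>L (p' \<star> \<lbrace>p, ?a\<rbrace>)"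
    using r assms by (simp add: lift_mult_d2_right)
  then show "F (rep'' m k r) = 0"
    using r assms F by (simp add: maps_lin_simps J2_rules[OF F] CM3_i group_assoc)
qed

text \<open>By the first axiom \<open>\<partial>\<^sub>2 \<lbrace>p, a\<rbrace> p a = (\<partial>\<^sub>1 p \<rhd>\<^sub>M a) p\<close>: the boundary of \<open>\<lambda>''\<close> compares the
  two orders in which \<open>p\<close> and \<open>a = n \<rhd>\<^sub>M m\<close> can be composed.\<close>

lemma one_homotopy_deg1:
  assumes "m \<in> M" "k \<in> N" "p \<in> M" "n \<in> N"
  shows "rep' m k (tau2 \<XX> (gen2 p n)) - tau3 \<XX> (rep'' m k (gen2 p n)) -
    (shift (\<partial>\<^sub>1 m \<cdot>\<^sub>N k) (gen2 p n) - shift k (gen2 p n)) \<in> J1 \<XX>"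
proof (rule mem_if_killed[OF subspace_J1])
  fix F assume F: "kills F (J1 \<XX>)"
  show "F (rep' m k (tau2 \<XX> (gen2 p n)) - tau3 \<XX> (rep'' m k (gen2 p n)) -
    (shift (\<partial>\<^sub>1 m \<cdot>\<^sub>N k) (gen2 p n) - shift k (gen2 p n))) = 0"
    using assms by (simp add: maps_lin_simps J1_rules[OF F] CM1 group_assoc)
qed

lemma one_homotopy_deg2:
  assumes "m \<in> M" "k \<in> N" "l \<in> L" "p \<in> M" "n \<in> N"
  shows "- rep'' m k (tau3 \<XX> (gen3 l p n)) -
    (shift (\<partial>\<^sub>1 m \<cdot>\<^sub>N k) (gen3 l p n) - shift k (gen3 l p n)) \<in> J2 \<XX>"
proof (rule mem_if_killed[OF subspace_J2])
  fix F assume F: "kills F (J2 \<XX>)"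
  \<comment> \<open>Splitting the product before applying \<open>rep''\<close> leaves only liftings of the form \<open>\<lbrace>\<partial>\<^sub>2 l, a\<rbrace>\<close>.\<close>
  have "F (rep'' m k (gen2 (\<partial>\<^sub>2 l \<cdot>\<^sub>M p) n)) =
      F (rep'' m k (gen2 p n)) + F (rep'' m k (gen2 (\<partial>\<^sub>2 l) (\<partial>\<^sub>1 p \<cdot>\<^sub>N n)))"
  proof -
    have "kills (\<lambda>x. F (rep'' m k x)) (J1 \<XX>)"
      using F rep''_J1_J2 assms by (auto simp: kills_def intro: lin_comp)
    from kills_J1_gen2_mult[OF this] show ?thesis using assms by simp
  qed
  then show "F (- rep'' m k (tau3 \<XX> (gen3 l p n)) -
    (shift (\<partial>\<^sub>1 m \<cdot>\<^sub>N k) (gen3 l p n) - shift k (gen3 l p n))) = 0"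
    using assms
    by (simp add: maps_lin_simps J2_rules[OF F] fs_pair.linear_neg[OF kills_lin[OF F]]
        lift_d2_left group_assoc)
qed

lemma two_homotopy_deg1:
  assumes "l \<in> L" "m \<in> M" "k \<in> N" "p \<in> M" "n \<in> N"
  shows "rep_alpha l m k (tau2 \<XX> (gen2 p n)) - (rep'' (\<partial>\<^sub>2 l \<cdot>\<^sub>M m) k (gen2 p n) - rep'' m k (gen2 p n)) \<in> J2 \<XX>"
proof (rule mem_if_killed[OF subspace_J2])
  fix F assume F: "kills F (J2 \<XX>)"
  have *: "\<lbrace>p, \<partial>\<^sub>2 (n \<rhd>\<^sub>L l) \<cdot>\<^sub>M n \<rhd>\<^sub>M m\<rbrace> =
      \<partial>\<^sub>1 p \<rhd>\<^sub>L n \<rhd>\<^sub>L l \<cdot>\<^sub>L \<lbrace>p, n \<rhd>\<^sub>M m\<rbrace> \<cdot>\<^sub>L inv\<^sub>L (p \<star> n \<rhd>\<^sub>L l)"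
    by (rule lift_mult_d2_right) (use assms in auto)
  show "F (rep_alpha l m k (tau2 \<XX> (gen2 p n)) -
      (rep'' (\<partial>\<^sub>2 l \<cdot>\<^sub>M m) k (gen2 p n) - rep'' m k (gen2 p n))) = 0"
    using assms *
    by (simp add: maps_lin_simps J2_rules[OF F] group_assoc)
qed

lemma rep_vertical':
  assumes "m \<in> M" "m' \<in> M" "k \<in> N" "n \<in> N"
  shows "rep' (m' \<cdot>\<^sub>M m) k (\<e> (\<one>\<^sub>L, \<one>\<^sub>M, n)) -
    (rep' m' (\<partial>\<^sub>1 m \<cdot>\<^sub>N k) (\<e> (\<one>\<^sub>L, \<one>\<^sub>M, n)) + rep' m k (\<e> (\<one>\<^sub>L, \<one>\<^sub>M, n))) \<in> J1 \<XX>"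
proof (rule mem_if_killed[OF subspace_J1])
  fix F assume F: "kills F (J1 \<XX>)"
  show "F (rep' (m' \<cdot>\<^sub>M m) k (\<e> (\<one>\<^sub>L, \<one>\<^sub>M, n)) -
    (rep' m' (\<partial>\<^sub>1 m \<cdot>\<^sub>N k) (\<e> (\<one>\<^sub>L, \<one>\<^sub>M, n)) + rep' m k (\<e> (\<one>\<^sub>L, \<one>\<^sub>M, n)))) = 0"
    using assms by (simp add: J1_rules[OF F] group_assoc)
qed

lemma rep_vertical'':
  assumes "m \<in> M" "m' \<in> M" "k \<in> N" "p \<in> M" "n \<in> N"
  shows "rep'' (m' \<cdot>\<^sub>M m) k (gen2 p n) -
    (rep'' m' (\<partial>\<^sub>1 m \<cdot>\<^sub>N k) (gen2 p n) + rep'' m k (gen2 p n)) \<in> J2 \<XX>"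
proof (rule mem_if_killed[OF subspace_J2])
  fix F assume F: "kills F (J2 \<XX>)"
  show "F (rep'' (m' \<cdot>\<^sub>M m) k (gen2 p n) -
    (rep'' m' (\<partial>\<^sub>1 m \<cdot>\<^sub>N k) (gen2 p n) + rep'' m k (gen2 p n))) = 0"
    using assms by (simp add: J2_rules[OF F] CM3_ii group_assoc)
qed

lemma rep_alpha_vertical2:
  assumes "l \<in> L" "l' \<in> L" "m \<in> M" "k \<in> N" "n \<in> N"
  shows "rep_alpha (l' \<cdot>\<^sub>L l) m k (\<e> (\<one>\<^sub>L, \<one>\<^sub>M, n)) -
    (rep_alpha l' (\<partial>\<^sub>2 l \<cdot>\<^sub>M m) k (\<e> (\<one>\<^sub>L, \<one>\<^sub>M, n)) + rep_alpha l m k (\<e> (\<one>\<^sub>L, \<one>\<^sub>M, n))) \<in> J2 \<XX>"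
proof (rule mem_if_killed[OF subspace_J2])
  fix F assume F: "kills F (J2 \<XX>)"
  show "F (rep_alpha (l' \<cdot>\<^sub>L l) m k (\<e> (\<one>\<^sub>L, \<one>\<^sub>M, n)) -
    (rep_alpha l' (\<partial>\<^sub>2 l \<cdot>\<^sub>M m) k (\<e> (\<one>\<^sub>L, \<one>\<^sub>M, n)) + rep_alpha l m k (\<e> (\<one>\<^sub>L, \<one>\<^sub>M, n)))) = 0"
    using assms by (simp add: J2_rules[OF F] group_assoc)
qed

lemma rep_alpha_vertical1:
  assumes "l \<in> L" "l' \<in> L" "m \<in> M" "m' \<in> M" "k \<in> N" "n \<in> N"
  shows "rep_alpha (l' \<cdot>\<^sub>L m' \<star> l) (m' \<cdot>\<^sub>M m) k (\<e> (\<one>\<^sub>L, \<one>\<^sub>M, n)) -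
    (rep_alpha l' m' (\<partial>\<^sub>1 m \<cdot>\<^sub>N k) (\<e> (\<one>\<^sub>L, \<one>\<^sub>M, n)) + rep_alpha l m k (\<e> (\<one>\<^sub>L, \<one>\<^sub>M, n))) \<in> J2 \<XX>"
proof (rule mem_if_killed[OF subspace_J2])
  fix F assume F: "kills F (J2 \<XX>)"
  show "F (rep_alpha (l' \<cdot>\<^sub>L m' \<star> l) (m' \<cdot>\<^sub>M m) k (\<e> (\<one>\<^sub>L, \<one>\<^sub>M, n)) -
    (rep_alpha l' m' (\<partial>\<^sub>1 m \<cdot>\<^sub>N k) (\<e> (\<one>\<^sub>L, \<one>\<^sub>M, n)) + rep_alpha l m k (\<e> (\<one>\<^sub>L, \<one>\<^sub>M, n)))) = 0"
    using assms by (simp add: J2_rules[OF F] group_assoc)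
qed

section \<open>The complex and its presentations\<close>

abbreviation q2 :: "('l, 'm, 'n, 'k::field) vec \<Rightarrow> ('l, 'm, 'n, 'k) vec set" where
  "q2 x \<equiv> J1 \<XX> +>\<^bsub>group_algebra (cells2 \<XX>)\<^esub> x"

abbreviation q3 :: "('l, 'm, 'n, 'k::field) vec \<Rightarrow> ('l, 'm, 'n, 'k) vec set" where
  "q3 x \<equiv> J2 \<XX> +>\<^bsub>group_algebra (cells3 \<XX>)\<^esub> x"

definition gens1 :: "('l, 'm, 'n, 'k::field) vec set" where
  "gens1 = \<e> ` ({\<one>\<^sub>L} \<times> {\<one>\<^sub>M} \<times> N)"

definition gens2 :: "('l, 'm, 'n, 'k::field) vec set" where
  "gens2 = (\<lambda>(m, n). gen2 m n) ` (M \<times> N)"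

definition gens3 :: "('l, 'm, 'n, 'k::field) vec set" where
  "gens3 = (\<lambda>(l, m, n). gen3 l m n) ` (L \<times> M \<times> N)"

abbreviation reps1 :: "('l, 'm, 'n, 'k::field) vec set" where "reps1 \<equiv> fs.span gens1"
abbreviation reps2 :: "('l, 'm, 'n, 'k::field) vec set" where "reps2 \<equiv> fs.span gens2"
abbreviation reps3 :: "('l, 'm, 'n, 'k::field) vec set" where "reps3 \<equiv> fs.span gens3"

lemma basis_reps: "n \<in> N \<Longrightarrow> \<e> (\<one>\<^sub>L, \<one>\<^sub>M, n) \<in> reps1"
  and gen2_reps: "\<lbrakk>m \<in> M; n \<in> N\<rbrakk> \<Longrightarrow> gen2 m n \<in> reps2"
  and gen3_reps: "\<lbrakk>l \<in> L; m \<in> M; n \<in> N\<rbrakk> \<Longrightarrow> gen3 l m n \<in> reps3"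
  by (force simp: gens1_def gens2_def gens3_def intro!: fs.span_base)+

lemma reps1_eq: "reps1 = {x. Poly_Mapping.keys x \<subseteq> {\<one>\<^sub>L} \<times> {\<one>\<^sub>M} \<times> N}"
  by (auto simp only: gens1_def keys_subset_iff_span)

lemma reps2_eq:
  "(reps2 :: ('l, 'm, 'n, 'k::field) vec set) = {x. Poly_Mapping.keys x \<subseteq> {\<one>\<^sub>L} \<times> M \<times> N \<and> sigma2 \<XX> x = 0}" (is "_ = ?R")
proof
  have "gen2 m n \<in> ?R" if "m \<in> M" "n \<in> N" for m n
    using that by (auto simp only: keys_subset_iff_span gen2_def maps_gen mem_Collect_eq
        intro!: conjI fs.span_diff fs.span_base[OF imageI]) (auto simp: maps_lin_simps)
  moreover have "fs.subspace ?R"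
    by (intro fs.subspaceI) (auto simp: keys_subset_iff_span fs.span_zero fs.span_add fs.span_scale maps_lin_simps)
  ultimately show "reps2 \<subseteq> ?R"
    by (intro fs.span_minimal) (auto simp only: gens2_def)
  show "?R \<subseteq> reps2"
  proof
    fix x :: "('l, 'm, 'n, 'k) vec" assume "x \<in> ?R"
    then have "x \<in> fs.span ((\<lambda>c. \<e> c - \<e> (case c of (l, m, n) \<Rightarrow> (\<one>\<^sub>L, \<one>\<^sub>M, n))) ` ({\<one>\<^sub>L} \<times> M \<times> N))"
      by (intro basis_map_kernel_span) (auto simp: sigma2_def)
    moreover have "(\<lambda>c. \<e> c - \<e> (case c of (l, m, n) \<Rightarrow> (\<one>\<^sub>L, \<one>\<^sub>M, n))) ` ({\<one>\<^sub>L} \<times> M \<times> N) =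
        (gens2 :: ('l, 'm, 'n, 'k) vec set)"
      by (force simp: gens2_def gen2_def image_iff)
    ultimately show "x \<in> reps2" by (simp only:)
  qed
qed

lemma reps3_eq:
  "(reps3 :: ('l, 'm, 'n, 'k::field) vec set) = {x. Poly_Mapping.keys x \<subseteq> L \<times> M \<times> N \<and> sigma3 \<XX> x = 0}" (is "_ = ?R")
proof
  have "gen3 l m n \<in> ?R" if "l \<in> L" "m \<in> M" "n \<in> N" for l m n
    using that by (auto simp only: keys_subset_iff_span gen3_def maps_gen mem_Collect_eq
        intro!: conjI fs.span_diff fs.span_base[OF imageI]) (auto simp: maps_lin_simps)
  moreover have "fs.subspace ?R"
    by (intro fs.subspaceI) (auto simp: keys_subset_iff_span fs.span_zero fs.span_add fs.span_scale maps_lin_simps)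
  ultimately show "reps3 \<subseteq> ?R"
    by (intro fs.span_minimal) (auto simp only: gens3_def)
  show "?R \<subseteq> reps3"
  proof
    fix x :: "('l, 'm, 'n, 'k) vec" assume "x \<in> ?R"
    then have "x \<in> fs.span ((\<lambda>c. \<e> c - \<e> (case c of (l, m, n) \<Rightarrow> (\<one>\<^sub>L, m, n))) ` (L \<times> M \<times> N))"
      by (intro basis_map_kernel_span) (auto simp: sigma3_def)
    moreover have "(\<lambda>c. \<e> c - \<e> (case c of (l, m, n) \<Rightarrow> (\<one>\<^sub>L, m, n))) ` (L \<times> M \<times> N) =
        (gens3 :: ('l, 'm, 'n, 'k) vec set)"
      by (force simp: gens3_def gen3_def image_iff)
    ultimately show "x \<in> reps3" by (simp only:)
  qed
qed

lemma reps_keys: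
  "x \<in> reps1 \<Longrightarrow> Poly_Mapping.keys x \<subseteq> L \<times> M \<times> N"
  "x \<in> reps2 \<Longrightarrow> Poly_Mapping.keys x \<subseteq> L \<times> M \<times> N"
  "x \<in> reps3 \<Longrightarrow> Poly_Mapping.keys x \<subseteq> L \<times> M \<times> N"
  by (auto simp: reps1_eq reps2_eq reps3_eq)

lemma the_elem_coset:
  assumes "fs.subspace J" "\<And>j. j \<in> J \<Longrightarrow> f (j + x) = f x"
  shows "the_elem (f ` (J +>\<^bsub>group_algebra G\<^esub> x)) = f x"
proof -
  have "f ` (J +>\<^bsub>group_algebra G\<^esub> x) = {f x}"
    using assms fs.subspace_0[OF assms(1)] by (force simp: coset_group_algebra image_iff)
  then show ?thesis by simp
qed

lemma bar_maps:
  "sigma3_bar \<XX> (q3 x) = q2 (sigma3 \<XX> x)" "tau3_bar \<XX> (q3 x) = q2 (tau3 \<XX> x)"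
  "sigma2_bar \<XX> (q2 x) = sigma2 \<XX> x" "tau2_bar \<XX> (q2 x) = tau2 \<XX> x"
  unfolding sigma3_bar_def tau3_bar_def sigma2_bar_def tau2_bar_def
  by (rule the_elem_coset; simp add: subspace_J1 subspace_J2 sigma2_tau2_J1 sigma3_tau3_J2 maps_lin_simps
      coset_group_algebra_eq_iff)+

lemma presentation_alg2:
  "presentation (alg2 \<XX>) q2 {x. Poly_Mapping.keys x \<subseteq> {\<one>\<^sub>L} \<times> M \<times> N} (J1 \<XX>)"
  using presentation_quot_algebra[OF group_cells2 ideal_J1] by (simp add: alg2_def)

lemma presentation_alg3:
  "presentation (alg3 \<XX>) q3 {x. Poly_Mapping.keys x \<subseteq> L \<times> M \<times> N} (J2 \<XX>)"
  using presentation_quot_algebra[OF group_cells3 ideal_J2] by (simp add: alg3_def)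

lemma presentation_K1: "presentation (K1 \<XX>) (\<lambda>x. x) reps1 {0}"
proof -
  have "carrier (group_algebra (cells1 \<XX>)) = (reps1 :: ('l, 'm, 'n, 'k::field) vec set)"
    by (auto simp: reps1_eq)
  then show ?thesis
    by unfold_locales (auto simp: K1_def alg1_def)
qed

lemma presentation_K2: "presentation (K2 \<XX>) q2 reps2 (J1 \<XX>)"
  unfolding K2_def
proof (rule presentation.restrict[OF presentation_alg2])
  show "a_kernel (alg2 \<XX>) (alg1 \<XX>) (sigma2_bar \<XX>) = q2 ` reps2"
    by (auto simp: a_kernel_def' presentation.carrier_V[OF presentation_alg2] bar_maps reps2_eq alg1_def)
  show "reps2 \<subseteq> {x. Poly_Mapping.keys x \<subseteq> {\<one>\<^sub>L} \<times> M \<times> N}"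
    by (auto simp: reps2_eq)
qed simp

text \<open>For a coset in the kernel of \<open>\<sigma>\<^sub>3\<close>, a representative \<open>x\<close> satisfies only that \<open>\<sigma>\<^sub>3 x\<close> is in
  \<open>J1\<close>; subtracting \<open>\<sigma>\<^sub>3 x\<close> does not change the coset, since \<open>J1\<close> is contained in \<open>J2\<close>.\<close>

lemma presentation_K3:
  "presentation (K3 \<XX>) q3 (reps3 :: ('l, 'm, 'n, 'k::field) vec set) (J2 \<XX>)"
  unfolding K3_def
proof (rule presentation.restrict[OF presentation_alg3])
  interpret A3: presentation "alg3 \<XX>" q3 "{x :: ('l, 'm, 'n, 'k) vec. Poly_Mapping.keys x \<subseteq> L \<times> M \<times> N}" "J2 \<XX>"
    by (rule presentation_alg3)
  interpret A2: presentation "alg2 \<XX>" q2 "{x :: ('l, 'm, 'n, 'k) vec. Poly_Mapping.keys x \<subseteq> {\<one>\<^sub>L} \<times> M \<times> N}" "J1 \<XX>"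
    by (rule presentation_alg2)
  have zero_iff: "q2 y = \<zero>\<^bsub>alg2 \<XX>\<^esub> \<longleftrightarrow> y \<in> J1 \<XX>" for y :: "('l, 'm, 'n, 'k) vec"
    unfolding A2.zero_V coset_group_algebra_eq_iff[OF subspace_J1] by simp
  let ?S = "{x :: ('l, 'm, 'n, 'k) vec. Poly_Mapping.keys x \<subseteq> L \<times> M \<times> N \<and> sigma3 \<XX> x \<in> J1 \<XX>}"
  have kernel: "a_kernel (alg3 \<XX>) (alg2 \<XX>) (sigma3_bar \<XX>) =
      q3 ` ?S"
    by (rule Set.set_eqI) (auto simp: a_kernel_def' A3.carrier_V bar_maps zero_iff del: equalityI)
  show "a_kernel (alg3 \<XX>) (alg2 \<XX>) (sigma3_bar \<XX>) =
      q3 ` (reps3 :: ('l, 'm, 'n, 'k) vec set)"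
    unfolding kernel
  proof
    show "q3 ` reps3 \<subseteq> q3 ` ?S"
      using fs.subspace_0[OF subspace_J1] by (auto simp: reps3_eq)
    show "q3 ` ?S \<subseteq> q3 ` reps3"
    proof
      fix u assume "u \<in> q3 ` ?S"
      then obtain x where x: "u = q3 x" "Poly_Mapping.keys x \<subseteq> L \<times> M \<times> N" "sigma3 \<XX> x \<in> J1 \<XX>"
        by blast
      have "x - sigma3 \<XX> x \<in> reps3"
        by (rule lin_map_keys[where F = "\<lambda>x. x - sigma3 \<XX> x", OF _ _ _ x(2)])
          (auto intro: lin_minus gen3_reps simp: gen3_def[symmetric])
      moreover have "u = q3 (x - sigma3 \<XX> x)"
        using J1_subset_J2[OF x(3)] by (simp add: x(1) coset_group_algebra_eq_iff[OF subspace_J2])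
      ultimately show "u \<in> q3 ` reps3" by blast
    qed
  qed
  show "reps3 \<subseteq> {x. Poly_Mapping.keys x \<subseteq> L \<times> M \<times> N}"
    by (auto simp: reps3_eq)
qed simp

interpretation K1: presentation "K1 \<XX>" "\<lambda>x. x" reps1 "{0}" by (rule presentation_K1)
interpretation K2: presentation "K2 \<XX>" q2 reps2 "J1 \<XX>" by (rule presentation_K2)
interpretation K3: presentation "K3 \<XX>" q3 reps3 "J2 \<XX>" by (rule presentation_K3)

lemma v11_eq: "\<lbrakk>m \<in> M; n \<in> N\<rbrakk> \<Longrightarrow> v11 \<XX> m n = q2 (gen2 m n)"
  by (simp add: v11_def gen2_def presentation.minus_q[OF presentation_alg2])

lemma v22_eq: "\<lbrakk>l \<in> L; m \<in> M; n \<in> N\<rbrakk> \<Longrightarrow> v22 \<XX> l m n = q3 (gen3 l m n)"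
  by (simp add: v22_def gen3_def presentation.minus_q[OF presentation_alg3])

lemma reps1_map: "\<lbrakk>lin F; fs.subspace T; \<And>n. n \<in> N \<Longrightarrow> F (\<e> (\<one>\<^sub>L, \<one>\<^sub>M, n)) \<in> T; x \<in> reps1\<rbrakk> \<Longrightarrow> F x \<in> T"
  and reps2_map: "\<lbrakk>lin F; fs.subspace T; \<And>m n. \<lbrakk>m \<in> M; n \<in> N\<rbrakk> \<Longrightarrow> F (gen2 m n) \<in> T; x \<in> reps2\<rbrakk> \<Longrightarrow> F x \<in> T"
  and reps3_map: "\<lbrakk>lin F; fs.subspace T; \<And>l m n. \<lbrakk>l \<in> L; m \<in> M; n \<in> N\<rbrakk> \<Longrightarrow> F (gen3 l m n) \<in> T;
    x \<in> reps3\<rbrakk> \<Longrightarrow> F x \<in> T"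
  by (rule lin_map_span; assumption?; auto simp: gens1_def gens2_def gens3_def)+

lemma maps_reps:
  "\<lbrakk>k \<in> N; x \<in> reps1\<rbrakk> \<Longrightarrow> shift k x \<in> reps1"
  "\<lbrakk>k \<in> N; x \<in> reps2\<rbrakk> \<Longrightarrow> shift k x \<in> reps2"
  "\<lbrakk>k \<in> N; x \<in> reps3\<rbrakk> \<Longrightarrow> shift k x \<in> reps3"
  "\<lbrakk>m \<in> M; k \<in> N; x \<in> reps1\<rbrakk> \<Longrightarrow> rep' m k x \<in> reps2"
  "\<lbrakk>m \<in> M; k \<in> N; x \<in> reps2\<rbrakk> \<Longrightarrow> rep'' m k x \<in> reps3"
  "\<lbrakk>l \<in> L; m \<in> M; k \<in> N; x \<in> reps1\<rbrakk> \<Longrightarrow> rep_alpha l m k x \<in> reps3"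
  "x \<in> reps3 \<Longrightarrow> tau3 \<XX> x \<in> reps2"
  "x \<in> reps2 \<Longrightarrow> tau2 \<XX> x \<in> reps1"
  by ((erule reps1_map[rotated 3] reps2_map[rotated 3] reps3_map[rotated 3]);
      simp add: basis_reps gen2_reps gen3_reps fs.span_diff)+

interpretation K11: presentation_pair "K1 \<XX>" "\<lambda>x. x" reps1 "{0}" "K1 \<XX>" "\<lambda>x. x" reps1 "{0}" ..
interpretation K12: presentation_pair "K1 \<XX>" "\<lambda>x. x" reps1 "{0}" "K2 \<XX>" q2 reps2 "J1 \<XX>" ..
interpretation K13: presentation_pair "K1 \<XX>" "\<lambda>x. x" reps1 "{0}" "K3 \<XX>" q3 reps3 "J2 \<XX>" ..
interpretation K21: presentation_pair "K2 \<XX>" q2 reps2 "J1 \<XX>" "K1 \<XX>" "\<lambda>x. x" reps1 "{0}" ..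
interpretation K22: presentation_pair "K2 \<XX>" q2 reps2 "J1 \<XX>" "K2 \<XX>" q2 reps2 "J1 \<XX>" ..
interpretation K23: presentation_pair "K2 \<XX>" q2 reps2 "J1 \<XX>" "K3 \<XX>" q3 reps3 "J2 \<XX>" ..
interpretation K32: presentation_pair "K3 \<XX>" q3 reps3 "J2 \<XX>" "K2 \<XX>" q2 reps2 "J1 \<XX>" ..
interpretation K33: presentation_pair "K3 \<XX>" q3 reps3 "J2 \<XX>" "K3 \<XX>" q3 reps3 "J2 \<XX>" ..

section \<open>The right regular representation\<close>

definition lam1 :: "'n \<Rightarrow> ('l, 'm, 'n, 'k::field) vec set \<Rightarrow> ('l, 'm, 'n, 'k) vec set" where
  "lam1 k = induced q2 reps2 q2 (shift k)"

definition lam2 :: "'n \<Rightarrow> ('l, 'm, 'n, 'k::field) vec set \<Rightarrow> ('l, 'm, 'n, 'k) vec set" where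
  "lam2 k = induced q3 reps3 q3 (shift k)"

definition lam' :: "'m \<Rightarrow> 'n \<Rightarrow> ('l, 'm, 'n, 'k::field) vec \<Rightarrow> ('l, 'm, 'n, 'k) vec set" where
  "lam' m k x = q2 (rep' m k x)"

definition lam'' :: "'m \<Rightarrow> 'n \<Rightarrow> ('l, 'm, 'n, 'k::field) vec set \<Rightarrow> ('l, 'm, 'n, 'k) vec set" where
  "lam'' m k = induced q2 reps2 q3 (rep'' m k)"

definition alpha :: "'l \<Rightarrow> 'm \<Rightarrow> 'n \<Rightarrow> ('l, 'm, 'n, 'k::field) vec \<Rightarrow> ('l, 'm, 'n, 'k) vec set" where
  "alpha l m k x = q3 (rep_alpha l m k x)"

lemma lam_eqs:
  "\<lbrakk>k \<in> N; x \<in> reps2\<rbrakk> \<Longrightarrow> lam1 k (q2 x) = q2 (shift k x)"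
  "\<lbrakk>k \<in> N; x \<in> reps3\<rbrakk> \<Longrightarrow> lam2 k (q3 x) = q3 (shift k x)"
  "\<lbrakk>m \<in> M; k \<in> N; x \<in> reps2\<rbrakk> \<Longrightarrow> lam'' m k (q2 x) = q3 (rep'' m k x)"
  unfolding lam1_def lam2_def lam''_def
  by (intro K22.induced_eq K33.induced_eq K23.induced_eq maps_reps shift_J rep''_J1_J2 lin_maps;
      assumption)+

lemma lam_on_generators:
  "n \<in> N \<Longrightarrow> shift k (e1 \<XX> n) = e1 \<XX> (n \<cdot>\<^sub>N k)"
  "\<lbrakk>k \<in> N; m \<in> M; n \<in> N\<rbrakk> \<Longrightarrow> lam1 k (v11 \<XX> m n) = v11 \<XX> m (n \<cdot>\<^sub>N k)"
  "\<lbrakk>k \<in> N; l \<in> L; m \<in> M; n \<in> N\<rbrakk> \<Longrightarrow> lam2 k (v22 \<XX> l m n) = v22 \<XX> l m (n \<cdot>\<^sub>N k)"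
  "\<lbrakk>m \<in> M; k \<in> N; n \<in> N\<rbrakk> \<Longrightarrow> lam' m k (e1 \<XX> n) = v11 \<XX> (n \<rhd>\<^sub>M m) (n \<cdot>\<^sub>N k)"
  "\<lbrakk>m \<in> M; k \<in> N; p \<in> M; n \<in> N\<rbrakk> \<Longrightarrow>
    lam'' m k (v11 \<XX> p n) = v22 \<XX> \<lbrace>p, n \<rhd>\<^sub>M m\<rbrace> (p \<cdot>\<^sub>M n \<rhd>\<^sub>M m) (n \<cdot>\<^sub>N k)"
  "\<lbrakk>l \<in> L; m \<in> M; k \<in> N; n \<in> N\<rbrakk> \<Longrightarrow>
    alpha l m k (e1 \<XX> n) = v22 \<XX> (n \<rhd>\<^sub>L l) (n \<rhd>\<^sub>M m) (n \<cdot>\<^sub>N k)"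
  by (simp_all add: e1_def v11_eq v22_eq lam_eqs lam'_def alpha_def gen2_reps gen3_reps)

lemmas lin_intros = lin_maps lin_maps[THEN lin_comp] lin_minus lin_plus lin_neg lin_id

lemma shift_shift:
  assumes "k \<in> N" "k' \<in> N" "Poly_Mapping.keys x \<subseteq> L \<times> M \<times> N"
  shows "shift (k \<cdot>\<^sub>N k') x = shift k' (shift k x)" and "shift \<one>\<^sub>N x = x"
  by (rule lin_eq_keys[OF _ _ _ assms(3)];
      use assms in \<open>auto simp: group_assoc intro: lin_intros\<close>)+

lemma shift_inv:
  assumes "k \<in> N" "Poly_Mapping.keys x \<subseteq> L \<times> M \<times> N"
  shows "shift (inv\<^sub>N k) (shift k x) = x" "shift k (shift (inv\<^sub>N k) x) = x"
  using assms shift_shift(1)[of k "inv\<^sub>N k" x] shift_shift(1)[of "inv\<^sub>N k" k x] shift_shift(2)[of k k x]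
  by simp_all

lemma shift_tau:
  assumes "k \<in> N"
  shows "x \<in> reps2 \<Longrightarrow> tau2 \<XX> (shift k x) = shift k (tau2 \<XX> x)"
    and "x \<in> reps3 \<Longrightarrow> tau3 \<XX> (shift k x) = shift k (tau3 \<XX> x)"
  by (rule lin_eq_span; use assms in \<open>auto simp: gens2_def gens3_def maps_lin_simps group_assoc intro!: lin_intros\<close>)+

lemma tau2_tau3: "x \<in> reps3 \<Longrightarrow> tau2 \<XX> (tau3 \<XX> x) = 0"
  by (rule lin_eq_span; auto simp: gens3_def maps_lin_simps group_assoc intro!: lin_intros)

lemma delta_bar_simps [simp]:
  "deg2 (delta_bar \<XX>) = K3 \<XX>" "deg1 (delta_bar \<XX>) = K2 \<XX>" "deg0 (delta_bar \<XX>) = K1 \<XX>"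
  "diff2 (delta_bar \<XX>) = tau3_bar \<XX>" "diff1 (delta_bar \<XX>) = tau2_bar \<XX>"
  by (simp_all add: delta_bar_def)

lemmas K_simps = K1.carrier_V K2.carrier_V K3.carrier_V K1.zero_V lam_eqs bar_maps maps_reps
  K1.add_q K2.add_q K3.add_q K1.minus_q K2.minus_q K3.minus_q K3.uminus_q

lemma is_complex_delta_bar: "is_complex (delta_bar \<XX>)"
  unfolding is_complex_def
  by (auto simp: K_simps K1.vect_space_V K2.vect_space_V K3.vect_space_V tau2_tau3
      intro!: K32.lin_mapI[where F = "tau3 \<XX>"] K21.lin_mapI[where F = "tau2 \<XX>"])

lemma lam_functor:
  assumes "k \<in> N" "k' \<in> N"
  shows "x \<in> carrier (K1 \<XX>) \<Longrightarrow> shift (k \<cdot>\<^sub>N k') x = shift k' (shift k x)"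
    and "y \<in> carrier (K2 \<XX>) \<Longrightarrow> lam1 (k \<cdot>\<^sub>N k') y = lam1 k' (lam1 k y)"
    and "z \<in> carrier (K3 \<XX>) \<Longrightarrow> lam2 (k \<cdot>\<^sub>N k') z = lam2 k' (lam2 k z)"
  using assms by (auto simp: K_simps shift_shift reps_keys)

lemma lin_map_lam:
  assumes "k \<in> N"
  shows "lin_map (K1 \<XX>) (K1 \<XX>) (shift k)"
    and "lin_map (K2 \<XX>) (K2 \<XX>) (lam1 k)"
    and "lin_map (K3 \<XX>) (K3 \<XX>) (lam2 k)"
    and "m \<in> M \<Longrightarrow> lin_map (K1 \<XX>) (K2 \<XX>) (lam' m k)"
    and "m \<in> M \<Longrightarrow> lin_map (K2 \<XX>) (K3 \<XX>) (lam'' m k)"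
    and "\<lbrakk>l \<in> L; m \<in> M\<rbrakk> \<Longrightarrow> lin_map (K1 \<XX>) (K3 \<XX>) (alpha l m k)"
  by (rule K11.lin_mapI[OF lin_maps(1)] K22.lin_mapI[OF lin_maps(1)] K33.lin_mapI[OF lin_maps(1)]
      K12.lin_mapI[OF lin_maps(2)] K23.lin_mapI[OF lin_maps(3)] K13.lin_mapI[OF lin_maps(4)];
      simp add: assms lam_eqs maps_reps lam'_def alpha_def)+

lemma chain_aut_lam:
  assumes k: "k \<in> N"
  shows "chain_aut (delta_bar \<XX>) (lam2 k, lam1 k, shift k)"
proof -
  have "bij_betw (shift k) (carrier (K1 \<XX>)) (carrier (K1 \<XX>))"
    by (rule bij_betw_byWitness[where f' = "shift (inv\<^sub>N k)"])
      (use k in \<open>auto simp: K1.carrier_V maps_reps shift_inv reps_keys\<close>)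
  moreover have "bij_betw (lam1 k) (carrier (K2 \<XX>)) (carrier (K2 \<XX>))"
    by (rule bij_betw_byWitness[where f' = "lam1 (inv\<^sub>N k)"])
      (use k in \<open>auto simp: K2.carrier_V lam_eqs maps_reps shift_inv reps_keys\<close>)
  moreover have "bij_betw (lam2 k) (carrier (K3 \<XX>)) (carrier (K3 \<XX>))"
    by (rule bij_betw_byWitness[where f' = "lam2 (inv\<^sub>N k)"])
      (use k in \<open>auto simp: K3.carrier_V lam_eqs maps_reps shift_inv reps_keys\<close>)
  ultimately show ?thesis
    using lin_map_lam(1-3)[OF k] k
    by (simp add: chain_aut_def K2.carrier_V K3.carrier_V lam_eqs bar_maps maps_reps shift_tau)
qed

lemma one_homotopy_lam:
  assumes m: "m \<in> M" and k: "k \<in> N"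
  defines "k' \<equiv> \<partial>\<^sub>1 m \<cdot>\<^sub>N k"
  shows "one_homotopy (delta_bar \<XX>)
    (lam2 k :: ('l, 'm, 'n, 'k::field) vec set \<Rightarrow> _, lam1 k, shift k) (lam2 k', lam1 k', shift k')
    (lam' m k) (lam'' m k)"
proof -
  have k': "k' \<in> N" using m k by (simp add: k'_def)
  let ?F1 = "\<lambda>x. rep' m k (tau2 \<XX> x) - tau3 \<XX> (rep'' m k x)" and ?F2 = "\<lambda>x. - rep'' m k (tau3 \<XX> x)"
  let ?G = "\<lambda>x. shift k' x - shift k x"
  have "tau2 \<XX> (rep' m k x) = ?G x" if "x \<in> reps1" for x :: "('l, 'm, 'n, 'k) vec"
    by (rule lin_eq_span[where F = "\<lambda>x. tau2 \<XX> (rep' m k x)" and G = ?G, OF _ _ _ that])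
      (use m k in \<open>auto simp: gens1_def k'_def group_assoc intro!: lin_intros\<close>)
  moreover have "q2 (?F1 x) = q2 (?G x)" if "x \<in> reps2" for x :: "('l, 'm, 'n, 'k) vec"
  proof (rule K22.q'_eqI[where F = ?F1 and G = ?G, OF _ _ _ _ _ that order_refl])
    show "lin ?F1" "lin ?G" by (intro lin_intros)+
    show "?F1 b - ?G b \<in> J1 \<XX>" if "b \<in> gens2" for b
      using that one_homotopy_deg1[OF m k] by (auto simp only: gens2_def k'_def)
  qed (use m k k' in \<open>simp_all add: maps_reps K2.closed\<close>)
  moreover have "q3 (?F2 x) = q3 (?G x)" if "x \<in> reps3" for x :: "('l, 'm, 'n, 'k) vec"
  proof (rule K33.q'_eqI[where F = ?F2 and G = ?G, OF _ _ _ _ _ that order_refl])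
    show "lin ?F2" "lin ?G"
      by (intro lin_intros)+
    show "?F2 b - ?G b \<in> J2 \<XX>" if "b \<in> gens3" for b
      using that one_homotopy_deg2[OF m k] by (auto simp only: gens3_def k'_def)
  qed (use m k k' in \<open>simp_all add: maps_reps K3.closed\<close>)
  ultimately show ?thesis
    using m k k' lin_map_lam(4,5)[OF k m]
    by (simp add: one_homotopy_def K_simps lam'_def)
qed

lemma two_homotopy_lam:
  assumes l: "l \<in> L" and m: "m \<in> M" and k: "k \<in> N"
  defines "k' \<equiv> \<partial>\<^sub>1 m \<cdot>\<^sub>N k" and "m' \<equiv> \<partial>\<^sub>2 l \<cdot>\<^sub>M m"
  shows "two_homotopy (delta_bar \<XX>)
    (lam2 k :: ('l, 'm, 'n, 'k::field) vec set \<Rightarrow> _, lam1 k, shift k) (lam2 k', lam1 k', shift k')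
    (lam' m k, lam'' m k) (lam' m' k, lam'' m' k) (alpha l m k)"
proof -
  have m': "m' \<in> M" and k': "\<partial>\<^sub>1 m' \<cdot>\<^sub>N k = k'"
    using l m k by (simp_all add: m'_def k'_def)
  let ?F1 = "\<lambda>x. tau3 \<XX> (rep_alpha l m k x)" and ?G1 = "\<lambda>x. rep' m' k x - rep' m k x"
  let ?F2 = "\<lambda>x. rep_alpha l m k (tau2 \<XX> x)" and ?G2 = "\<lambda>x. rep'' m' k x - rep'' m k x"
  have "?F1 x = ?G1 x" if "x \<in> reps1" for x :: "('l, 'm, 'n, 'k) vec"
    by (rule lin_eq_span[where F = ?F1 and G = ?G1, OF _ _ _ that])
      (use l m k in \<open>auto simp: gens1_def m'_def intro!: lin_intros\<close>)
  moreover have "q3 (?F2 x) = q3 (?G2 x)" if "x \<in> reps2" for x :: "('l, 'm, 'n, 'k) vec"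
  proof (rule K23.q'_eqI[where F = ?F2 and G = ?G2, OF _ _ _ _ _ that order_refl])
    show "lin ?F2" "lin ?G2" by (intro lin_intros)+
    show "?F2 b - ?G2 b \<in> J2 \<XX>" if "b \<in> gens2" for b
      using that two_homotopy_deg1[OF l m k] by (auto simp only: gens2_def m'_def)
  qed (use l m m' k in \<open>simp_all add: maps_reps K3.closed\<close>)
  ultimately show ?thesis
    using l m m' k lin_map_lam(6)[OF k l m] one_homotopy_lam[OF m k] one_homotopy_lam[OF m' k]
    by (simp add: two_homotopy_def K_simps lam'_def alpha_def k' k'_def[symmetric])
qed

subsection \<open>Compositions\<close>

lemma lam_vertical:
  assumes m: "m \<in> M" "m' \<in> M" and k: "k \<in> N"
  shows "x \<in> carrier (K1 \<XX>) \<Longrightarrow>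
      lam' (m' \<cdot>\<^sub>M m) k x = lam' m' (\<partial>\<^sub>1 m \<cdot>\<^sub>N k) x \<oplus>\<^bsub>K2 \<XX>\<^esub> lam' m k x"
    and "y \<in> carrier (K2 \<XX>) \<Longrightarrow>
      lam'' (m' \<cdot>\<^sub>M m) k y = lam'' m' (\<partial>\<^sub>1 m \<cdot>\<^sub>N k) y \<oplus>\<^bsub>K3 \<XX>\<^esub> lam'' m k y"
proof -
  let ?G1 = "\<lambda>x. rep' m' (\<partial>\<^sub>1 m \<cdot>\<^sub>N k) x + rep' m k x"
  assume "x \<in> carrier (K1 \<XX>)"
  then have x: "x \<in> reps1" by (simp add: K1.carrier_V)
  have "q2 (rep' (m' \<cdot>\<^sub>M m) k x) = q2 (?G1 x)"
  proof (rule K12.q'_eqI[where F = "rep' (m' \<cdot>\<^sub>M m) k" and G = ?G1, OF _ _ _ _ _ x order_refl])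
    show "lin (rep' (m' \<cdot>\<^sub>M m) k)" "lin ?G1" by (intro lin_intros)+
    show "rep' (m' \<cdot>\<^sub>M m) k b - ?G1 b \<in> J1 \<XX>" if "b \<in> gens1" for b
      using that rep_vertical'[OF m k] by (auto simp only: gens1_def)
  qed (use m k in \<open>simp_all add: maps_reps K2.closed\<close>)
  then show "lam' (m' \<cdot>\<^sub>M m) k x = lam' m' (\<partial>\<^sub>1 m \<cdot>\<^sub>N k) x \<oplus>\<^bsub>K2 \<XX>\<^esub> lam' m k x"
    using x m k by (simp add: lam'_def K_simps)
next
  let ?G2 = "\<lambda>x. rep'' m' (\<partial>\<^sub>1 m \<cdot>\<^sub>N k) x + rep'' m k x"
  assume "y \<in> carrier (K2 \<XX>)"
  then obtain x where x: "y = q2 x" "x \<in> reps2" by (auto simp: K2.carrier_V)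
  have "q3 (rep'' (m' \<cdot>\<^sub>M m) k x) = q3 (?G2 x)"
  proof (rule K23.q'_eqI[where F = "rep'' (m' \<cdot>\<^sub>M m) k" and G = ?G2, OF _ _ _ _ _ x(2) order_refl])
    show "lin (rep'' (m' \<cdot>\<^sub>M m) k)" "lin ?G2" by (intro lin_intros)+
    show "rep'' (m' \<cdot>\<^sub>M m) k b - ?G2 b \<in> J2 \<XX>" if "b \<in> gens2" for b
      using that rep_vertical''[OF m k] by (auto simp only: gens2_def)
  qed (use m k in \<open>simp_all add: maps_reps K3.closed\<close>)
  then show "lam'' (m' \<cdot>\<^sub>M m) k y = lam'' m' (\<partial>\<^sub>1 m \<cdot>\<^sub>N k) y \<oplus>\<^bsub>K3 \<XX>\<^esub> lam'' m k y"
    using x m k by (simp add: K_simps)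
qed

text \<open>Whiskering by a 1-cell holds on the nose for representatives. It reduces horizontal
  composites to vertical ones.\<close>

lemma whisker_left_reps:
  assumes "m \<in> M" "k \<in> N" "n \<in> N"
  shows "x \<in> reps1 \<Longrightarrow> rep' (n \<rhd>\<^sub>M m) (n \<cdot>\<^sub>N k) x = rep' m k (shift n x)"
    and "x \<in> reps2 \<Longrightarrow> rep'' (n \<rhd>\<^sub>M m) (n \<cdot>\<^sub>N k) x = rep'' m k (shift n x)"
    and "\<lbrakk>l \<in> L; x \<in> reps1\<rbrakk> \<Longrightarrow> rep_alpha (n \<rhd>\<^sub>L l) (n \<rhd>\<^sub>M m) (n \<cdot>\<^sub>N k) x = rep_alpha l m k (shift n x)"
  by (rule lin_eq_span;
      use assms in \<open>auto simp: gens1_def gens2_def group_assoc intro!: lin_intros\<close>)+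

lemma whisker_right_reps:
  assumes "m \<in> M" "k \<in> N" "n \<in> N"
  shows "x \<in> reps1 \<Longrightarrow> rep' m (k \<cdot>\<^sub>N n) x = shift n (rep' m k x)"
    and "x \<in> reps2 \<Longrightarrow> rep'' m (k \<cdot>\<^sub>N n) x = shift n (rep'' m k x)"
    and "\<lbrakk>l \<in> L; x \<in> reps1\<rbrakk> \<Longrightarrow> rep_alpha l m (k \<cdot>\<^sub>N n) x = shift n (rep_alpha l m k x)"
  by (rule lin_eq_span;
      use assms in \<open>auto simp: gens1_def gens2_def group_assoc intro!: lin_intros\<close>)+

lemma whisker_left:
  assumes "m \<in> M" "k \<in> N" "n \<in> N"
  shows "x \<in> carrier (K1 \<XX>) \<Longrightarrow> lam' (n \<rhd>\<^sub>M m) (n \<cdot>\<^sub>N k) x = lam' m k (shift n x)"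
    and "y \<in> carrier (K2 \<XX>) \<Longrightarrow> lam'' (n \<rhd>\<^sub>M m) (n \<cdot>\<^sub>N k) y = lam'' m k (lam1 n y)"
    and "\<lbrakk>l \<in> L; x \<in> carrier (K1 \<XX>)\<rbrakk> \<Longrightarrow>
      alpha (n \<rhd>\<^sub>L l) (n \<rhd>\<^sub>M m) (n \<cdot>\<^sub>N k) x = alpha l m k (shift n x)"
  using assms
  by (auto simp: K1.carrier_V K2.carrier_V lam'_def alpha_def lam_eqs maps_reps whisker_left_reps)

lemma whisker_right:
  assumes "m \<in> M" "k \<in> N" "n \<in> N"
  shows "x \<in> carrier (K1 \<XX>) \<Longrightarrow> lam' m (k \<cdot>\<^sub>N n) x = lam1 n (lam' m k x)"
    and "y \<in> carrier (K2 \<XX>) \<Longrightarrow> lam'' m (k \<cdot>\<^sub>N n) y = lam2 n (lam'' m k y)"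
    and "\<lbrakk>l \<in> L; x \<in> carrier (K1 \<XX>)\<rbrakk> \<Longrightarrow> alpha l m (k \<cdot>\<^sub>N n) x = lam2 n (alpha l m k x)"
  using assms
  by (auto simp: K1.carrier_V K2.carrier_V lam'_def alpha_def lam_eqs maps_reps whisker_right_reps)

lemma alpha_vertical:
  assumes l: "l \<in> L" "l' \<in> L" and m: "m \<in> M" "m' \<in> M" and k: "k \<in> N" and x: "x \<in> carrier (K1 \<XX>)"
  shows "alpha (l' \<cdot>\<^sub>L l) m k x = alpha l' (\<partial>\<^sub>2 l \<cdot>\<^sub>M m) k x \<oplus>\<^bsub>K3 \<XX>\<^esub> alpha l m k x"
    and "alpha (l' \<cdot>\<^sub>L m' \<star> l) (m' \<cdot>\<^sub>M m) k x =
      alpha l' m' (\<partial>\<^sub>1 m \<cdot>\<^sub>N k) x \<oplus>\<^bsub>K3 \<XX>\<^esub> alpha l m k x"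
proof -
  have x: "x \<in> reps1" using x by (simp add: K1.carrier_V)
  let ?F = "rep_alpha (l' \<cdot>\<^sub>L l) m k" and ?G = "\<lambda>x. rep_alpha l' (\<partial>\<^sub>2 l \<cdot>\<^sub>M m) k x + rep_alpha l m k x"
  have "q3 (?F x) = q3 (?G x)"
  proof (rule K13.q'_eqI[where F = ?F and G = ?G, OF _ _ _ _ _ x order_refl])
    show "lin ?F" "lin ?G" by (intro lin_intros)+
    show "?F b - ?G b \<in> J2 \<XX>" if "b \<in> gens1" for b
      using that rep_alpha_vertical2[OF l m(1) k] by (auto simp only: gens1_def)
  qed (use l m k in \<open>simp_all add: maps_reps K3.closed\<close>)
  then show "alpha (l' \<cdot>\<^sub>L l) m k x = alpha l' (\<partial>\<^sub>2 l \<cdot>\<^sub>M m) k x \<oplus>\<^bsub>K3 \<XX>\<^esub> alpha l m k x"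
    using x l m k by (simp add: alpha_def K_simps)
  let ?F = "rep_alpha (l' \<cdot>\<^sub>L m' \<star> l) (m' \<cdot>\<^sub>M m) k" and ?G = "\<lambda>x. rep_alpha l' m' (\<partial>\<^sub>1 m \<cdot>\<^sub>N k) x + rep_alpha l m k x"
  have "q3 (?F x) = q3 (?G x)"
  proof (rule K13.q'_eqI[where F = ?F and G = ?G, OF _ _ _ _ _ x order_refl])
    show "lin ?F" "lin ?G" by (intro lin_intros)+
    show "?F b - ?G b \<in> J2 \<XX>" if "b \<in> gens1" for b
      using that rep_alpha_vertical1[OF l m k] by (auto simp only: gens1_def)
  qed (use l m k in \<open>simp_all add: maps_reps K3.closed\<close>)
  then show "alpha (l' \<cdot>\<^sub>L m' \<star> l) (m' \<cdot>\<^sub>M m) k x =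
      alpha l' m' (\<partial>\<^sub>1 m \<cdot>\<^sub>N k) x \<oplus>\<^bsub>K3 \<XX>\<^esub> alpha l m k x"
    using x l m k by (simp add: alpha_def K_simps)
qed

lemma lam_closed:
  assumes "m \<in> M" "k \<in> N"
  shows "x \<in> carrier (K1 \<XX>) \<Longrightarrow> shift k x \<in> carrier (K1 \<XX>)"
    and "y \<in> carrier (K2 \<XX>) \<Longrightarrow> lam1 k y \<in> carrier (K2 \<XX>)"
    and "z \<in> carrier (K3 \<XX>) \<Longrightarrow> lam2 k z \<in> carrier (K3 \<XX>)"
    and "x \<in> carrier (K1 \<XX>) \<Longrightarrow> lam' m k x \<in> carrier (K2 \<XX>)"
    and "y \<in> carrier (K2 \<XX>) \<Longrightarrow> lam'' m k y \<in> carrier (K3 \<XX>)"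
    and "\<lbrakk>l \<in> L; x \<in> carrier (K1 \<XX>)\<rbrakk> \<Longrightarrow> alpha l m k x \<in> carrier (K3 \<XX>)"
  using assms
  by (auto simp: K1.carrier_V K2.carrier_V K3.carrier_V lam'_def alpha_def lam_eqs maps_reps intro!: imageI)

lemma horizontal_target: "\<lbrakk>n \<in> N; m \<in> M; k \<in> N\<rbrakk> \<Longrightarrow> \<partial>\<^sub>1 (n \<rhd>\<^sub>M m) \<cdot>\<^sub>N (n \<cdot>\<^sub>N k) = n \<cdot>\<^sub>N (\<partial>\<^sub>1 m \<cdot>\<^sub>N k)"
  by (simp add: group_assoc)

text \<open>The product of \<open>(m, n)\<close> and \<open>(m', n')\<close> is the vertical composite of \<open>(n \<rhd>\<^sub>M m', n n')\<close>, which is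
  \<open>(m', n')\<close> whiskered by \<open>n\<close>, with \<open>(m, n \<partial>\<^sub>1 m' n')\<close>, which is \<open>(m, n)\<close> whiskered by \<open>\<partial>\<^sub>1 m' n'\<close>.\<close>

lemma lam_horizontal1:
  assumes "m \<in> M" "m' \<in> M" "n \<in> N" "n' \<in> N"
  shows "x \<in> carrier (K1 \<XX>) \<Longrightarrow> lam' (m \<cdot>\<^sub>M n \<rhd>\<^sub>M m') (n \<cdot>\<^sub>N n') x =
      lam' m' n' (shift n x) \<oplus>\<^bsub>K2 \<XX>\<^esub> lam1 (\<partial>\<^sub>1 m' \<cdot>\<^sub>N n') (lam' m n x)" (is "_ \<Longrightarrow> ?goal1")
    and "y \<in> carrier (K2 \<XX>) \<Longrightarrow> lam'' (m \<cdot>\<^sub>M n \<rhd>\<^sub>M m') (n \<cdot>\<^sub>N n') y =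
      lam'' m' n' (lam1 n y) \<oplus>\<^bsub>K3 \<XX>\<^esub> lam2 (\<partial>\<^sub>1 m' \<cdot>\<^sub>N n') (lam'' m n y)" (is "_ \<Longrightarrow> ?goal2")
proof -
  let ?k = "\<partial>\<^sub>1 m' \<cdot>\<^sub>N n'"
  have m': "n \<rhd>\<^sub>M m' \<in> M" and nn': "n \<cdot>\<^sub>N n' \<in> N" and k: "?k \<in> N"
    using assms by simp_all
  note target = horizontal_target[OF assms(3,2,4)]
  show ?goal1 if x: "x \<in> carrier (K1 \<XX>)"
    unfolding lam_vertical(1)[OF m' assms(1) nn' x] target whisker_left(1)[OF assms(2,4,3) x]
      whisker_right(1)[OF assms(1,3) k x]
    by (rule K2.add_commute) (use x k assms in \<open>simp_all add: lam_closed\<close>)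
  show ?goal2 if y: "y \<in> carrier (K2 \<XX>)"
    unfolding lam_vertical(2)[OF m' assms(1) nn' y] target whisker_left(2)[OF assms(2,4,3) y]
      whisker_right(2)[OF assms(1,3) k y]
    by (rule K3.add_commute) (use y k assms in \<open>simp_all add: lam_closed\<close>)
qed

text \<open>The other interchange: first \<open>(m, n)\<close> whiskered by \<open>n'\<close>, then \<open>(m', n')\<close> whiskered by the
  target \<open>\<partial>\<^sub>1 m n\<close>.\<close>

lemma lam_horizontal2:
  assumes "m \<in> M" "m' \<in> M" "n \<in> N" "n' \<in> N"
  shows "x \<in> carrier (K1 \<XX>) \<Longrightarrow> lam' ((\<partial>\<^sub>1 m \<cdot>\<^sub>N n) \<rhd>\<^sub>M m' \<cdot>\<^sub>M m) (n \<cdot>\<^sub>N n') x =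
      lam1 n' (lam' m n x) \<oplus>\<^bsub>K2 \<XX>\<^esub> lam' m' n' (shift (\<partial>\<^sub>1 m \<cdot>\<^sub>N n) x)" (is "_ \<Longrightarrow> ?goal1")
    and "y \<in> carrier (K2 \<XX>) \<Longrightarrow> lam'' ((\<partial>\<^sub>1 m \<cdot>\<^sub>N n) \<rhd>\<^sub>M m' \<cdot>\<^sub>M m) (n \<cdot>\<^sub>N n') y =
      lam2 n' (lam'' m n y) \<oplus>\<^bsub>K3 \<XX>\<^esub> lam'' m' n' (lam1 (\<partial>\<^sub>1 m \<cdot>\<^sub>N n) y)" (is "_ \<Longrightarrow> ?goal2")
proof -
  let ?n = "\<partial>\<^sub>1 m \<cdot>\<^sub>N n"
  have n: "?n \<in> N" and m': "?n \<rhd>\<^sub>M m' \<in> M" and nn': "n \<cdot>\<^sub>N n' \<in> N"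
    and assoc: "\<partial>\<^sub>1 m \<cdot>\<^sub>N (n \<cdot>\<^sub>N n') = ?n \<cdot>\<^sub>N n'"
    using assms by (simp_all add: group_assoc)
  show ?goal1 if x: "x \<in> carrier (K1 \<XX>)"
    unfolding lam_vertical(1)[OF assms(1) m' nn' x] assoc whisker_left(1)[OF assms(2,4) n x]
      whisker_right(1)[OF assms(1,3,4) x]
    by (rule K2.add_commute) (use x n assms in \<open>simp_all add: lam_closed\<close>)
  show ?goal2 if y: "y \<in> carrier (K2 \<XX>)"
    unfolding lam_vertical(2)[OF assms(1) m' nn' y] assoc whisker_left(2)[OF assms(2,4) n y]
      whisker_right(2)[OF assms(1,3,4) y]
    by (rule K3.add_commute) (use y n assms in \<open>simp_all add: lam_closed\<close>)
qed

text \<open>As for 2-cells, with the 1-vertical composition of 3-cells in place of the vertical one.\<close>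

lemma alpha_mult:
  assumes "l \<in> L" "l' \<in> L" "m \<in> M" "m' \<in> M" "n \<in> N" "n' \<in> N" and x: "x \<in> carrier (K1 \<XX>)"
  shows "alpha (l \<cdot>\<^sub>L m \<star> n \<rhd>\<^sub>L l') (m \<cdot>\<^sub>M n \<rhd>\<^sub>M m') (n \<cdot>\<^sub>N n') x =
    lam2 (\<partial>\<^sub>1 m' \<cdot>\<^sub>N n') (alpha l m n x) \<oplus>\<^bsub>K3 \<XX>\<^esub> alpha l' m' n' (shift n x)"
proof -
  have l': "n \<rhd>\<^sub>L l' \<in> L" and m': "n \<rhd>\<^sub>M m' \<in> M" and nn': "n \<cdot>\<^sub>N n' \<in> N"
    and k: "\<partial>\<^sub>1 m' \<cdot>\<^sub>N n' \<in> N"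
    using assms by simp_all
  show ?thesis
    by (simp only: alpha_vertical(2)[OF l' assms(1) m' assms(3) nn' x] horizontal_target[OF assms(5,4,6)]
        whisker_left(3)[OF assms(4,6,5,2) x] whisker_right(3)[OF assms(3,5) k assms(1) x])
qed

end

theorem theorem6p2:
  fixes \<XX> :: "('l, 'm, 'n) two_crossed_data"
  assumes "two_crossed_module \<XX>"
  shows "is_complex (delta_bar \<XX> ::
      ('k::field, ('l, 'm, 'n, 'k) vec set, ('l, 'm, 'n, 'k) vec set, ('l, 'm, 'n, 'k) vec) complex2) \<and>
    (\<exists>(lam0 :: 'n \<Rightarrow> ('l, 'm, 'n, 'k) vec \<Rightarrow> ('l, 'm, 'n, 'k) vec)
      (lam1 :: 'n \<Rightarrow> ('l, 'm, 'n, 'k) vec set \<Rightarrow> ('l, 'm, 'n, 'k) vec set)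
      (lam2 :: 'n \<Rightarrow> ('l, 'm, 'n, 'k) vec set \<Rightarrow> ('l, 'm, 'n, 'k) vec set)
      (lam' :: 'm \<Rightarrow> 'n \<Rightarrow> ('l, 'm, 'n, 'k) vec \<Rightarrow> ('l, 'm, 'n, 'k) vec set)
      (lam'' :: 'm \<Rightarrow> 'n \<Rightarrow> ('l, 'm, 'n, 'k) vec set \<Rightarrow> ('l, 'm, 'n, 'k) vec set)
      (alpha :: 'l \<Rightarrow> 'm \<Rightarrow> 'n \<Rightarrow> ('l, 'm, 'n, 'k) vec \<Rightarrow> ('l, 'm, 'n, 'k) vec set).
      (\<forall>n\<in>carrier (grpN \<XX>).
        (\<forall>n'\<in>carrier (grpN \<XX>). lam0 n (e1 \<XX> n') = e1 \<XX> (n' \<otimes>\<^bsub>grpN \<XX>\<^esub> n)) \<and>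
        (\<forall>m'\<in>carrier (grpM \<XX>). \<forall>n'\<in>carrier (grpN \<XX>).
          lam1 n (v11 \<XX> m' n') = v11 \<XX> m' (n' \<otimes>\<^bsub>grpN \<XX>\<^esub> n)) \<and>
        (\<forall>l'\<in>carrier (grpL \<XX>). \<forall>m'\<in>carrier (grpM \<XX>). \<forall>n'\<in>carrier (grpN \<XX>).
          lam2 n (v22 \<XX> l' m' n') = v22 \<XX> l' m' (n' \<otimes>\<^bsub>grpN \<XX>\<^esub> n)) \<and>
        chain_aut (delta_bar \<XX>) (lam2 n, lam1 n, lam0 n)) \<and>
      (\<forall>n\<in>carrier (grpN \<XX>). \<forall>n'\<in>carrier (grpN \<XX>).
        (\<forall>x\<in>carrier (K1 \<XX>). lam0 (n \<otimes>\<^bsub>grpN \<XX>\<^esub> n') x = lam0 n' (lam0 n x)) \<and>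
        (\<forall>x\<in>carrier (K2 \<XX>). lam1 (n \<otimes>\<^bsub>grpN \<XX>\<^esub> n') x = lam1 n' (lam1 n x)) \<and>
        (\<forall>x\<in>carrier (K3 \<XX>). lam2 (n \<otimes>\<^bsub>grpN \<XX>\<^esub> n') x = lam2 n' (lam2 n x))) \<and>
      (\<forall>m\<in>carrier (grpM \<XX>). \<forall>n\<in>carrier (grpN \<XX>).
        (\<forall>n'\<in>carrier (grpN \<XX>).
          lam' m n (e1 \<XX> n') = v11 \<XX> (actM \<XX> n' m) (n' \<otimes>\<^bsub>grpN \<XX>\<^esub> n)) \<and>
        (\<forall>m'\<in>carrier (grpM \<XX>). \<forall>n'\<in>carrier (grpN \<XX>).
          lam'' m n (v11 \<XX> m' n') =
            v22 \<XX> (lift \<XX> m' (actM \<XX> n' m)) (m' \<otimes>\<^bsub>grpM \<XX>\<^esub> actM \<XX> n' m) (n' \<otimes>\<^bsub>grpN \<XX>\<^esub> n)) \<and>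
        one_homotopy (delta_bar \<XX>)
          (lam2 n, lam1 n, lam0 n)
          (lam2 (bdy1 \<XX> m \<otimes>\<^bsub>grpN \<XX>\<^esub> n), lam1 (bdy1 \<XX> m \<otimes>\<^bsub>grpN \<XX>\<^esub> n), lam0 (bdy1 \<XX> m \<otimes>\<^bsub>grpN \<XX>\<^esub> n))
          (lam' m n) (lam'' m n)) \<and>
      (\<forall>l\<in>carrier (grpL \<XX>). \<forall>m\<in>carrier (grpM \<XX>). \<forall>n\<in>carrier (grpN \<XX>).
        (\<forall>n'\<in>carrier (grpN \<XX>).
          alpha l m n (e1 \<XX> n') = v22 \<XX> (actL \<XX> n' l) (actM \<XX> n' m) (n' \<otimes>\<^bsub>grpN \<XX>\<^esub> n)) \<and>
        two_homotopy (delta_bar \<XX>)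
          (lam2 n, lam1 n, lam0 n)
          (lam2 (bdy1 \<XX> m \<otimes>\<^bsub>grpN \<XX>\<^esub> n), lam1 (bdy1 \<XX> m \<otimes>\<^bsub>grpN \<XX>\<^esub> n), lam0 (bdy1 \<XX> m \<otimes>\<^bsub>grpN \<XX>\<^esub> n))
          (lam' m n, lam'' m n)
          (lam' (bdy2 \<XX> l \<otimes>\<^bsub>grpM \<XX>\<^esub> m) n, lam'' (bdy2 \<XX> l \<otimes>\<^bsub>grpM \<XX>\<^esub> m) n)
          (alpha l m n)) \<and>
      (\<forall>m\<in>carrier (grpM \<XX>). \<forall>m'\<in>carrier (grpM \<XX>). \<forall>n\<in>carrier (grpN \<XX>).
        (\<forall>x\<in>carrier (K1 \<XX>). lam' (m' \<otimes>\<^bsub>grpM \<XX>\<^esub> m) n x =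
          lam' m' (bdy1 \<XX> m \<otimes>\<^bsub>grpN \<XX>\<^esub> n) x \<oplus>\<^bsub>K2 \<XX>\<^esub> lam' m n x) \<and>
        (\<forall>x\<in>carrier (K2 \<XX>). lam'' (m' \<otimes>\<^bsub>grpM \<XX>\<^esub> m) n x =
          lam'' m' (bdy1 \<XX> m \<otimes>\<^bsub>grpN \<XX>\<^esub> n) x \<oplus>\<^bsub>K3 \<XX>\<^esub> lam'' m n x)) \<and>
      (\<forall>m\<in>carrier (grpM \<XX>). \<forall>m'\<in>carrier (grpM \<XX>). \<forall>n\<in>carrier (grpN \<XX>). \<forall>n'\<in>carrier (grpN \<XX>).
        (\<forall>x\<in>carrier (K1 \<XX>).
          lam' (m \<otimes>\<^bsub>grpM \<XX>\<^esub> actM \<XX> n m') (n \<otimes>\<^bsub>grpN \<XX>\<^esub> n') x =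
            lam' m' n' (lam0 n x) \<oplus>\<^bsub>K2 \<XX>\<^esub> lam1 (bdy1 \<XX> m' \<otimes>\<^bsub>grpN \<XX>\<^esub> n') (lam' m n x)) \<and>
        (\<forall>x\<in>carrier (K2 \<XX>).
          lam'' (m \<otimes>\<^bsub>grpM \<XX>\<^esub> actM \<XX> n m') (n \<otimes>\<^bsub>grpN \<XX>\<^esub> n') x =
            lam'' m' n' (lam1 n x) \<oplus>\<^bsub>K3 \<XX>\<^esub> lam2 (bdy1 \<XX> m' \<otimes>\<^bsub>grpN \<XX>\<^esub> n') (lam'' m n x)) \<and>
        (\<forall>x\<in>carrier (K1 \<XX>).
          lam' (actM \<XX> (bdy1 \<XX> m \<otimes>\<^bsub>grpN \<XX>\<^esub> n) m' \<otimes>\<^bsub>grpM \<XX>\<^esub> m) (n \<otimes>\<^bsub>grpN \<XX>\<^esub> n') x =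
            lam1 n' (lam' m n x) \<oplus>\<^bsub>K2 \<XX>\<^esub> lam' m' n' (lam0 (bdy1 \<XX> m \<otimes>\<^bsub>grpN \<XX>\<^esub> n) x)) \<and>
        (\<forall>x\<in>carrier (K2 \<XX>).
          lam'' (actM \<XX> (bdy1 \<XX> m \<otimes>\<^bsub>grpN \<XX>\<^esub> n) m' \<otimes>\<^bsub>grpM \<XX>\<^esub> m) (n \<otimes>\<^bsub>grpN \<XX>\<^esub> n') x =
            lam2 n' (lam'' m n x) \<oplus>\<^bsub>K3 \<XX>\<^esub> lam'' m' n' (lam1 (bdy1 \<XX> m \<otimes>\<^bsub>grpN \<XX>\<^esub> n) x))) \<and>
      (\<forall>l\<in>carrier (grpL \<XX>). \<forall>l'\<in>carrier (grpL \<XX>). \<forall>m\<in>carrier (grpM \<XX>). \<forall>n\<in>carrier (grpN \<XX>).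
        \<forall>x\<in>carrier (K1 \<XX>).
          alpha (l' \<otimes>\<^bsub>grpL \<XX>\<^esub> l) m n x =
            alpha l' (bdy2 \<XX> l \<otimes>\<^bsub>grpM \<XX>\<^esub> m) n x \<oplus>\<^bsub>K3 \<XX>\<^esub> alpha l m n x) \<and>
      (\<forall>l\<in>carrier (grpL \<XX>). \<forall>l'\<in>carrier (grpL \<XX>). \<forall>m\<in>carrier (grpM \<XX>). \<forall>m'\<in>carrier (grpM \<XX>).
        \<forall>n\<in>carrier (grpN \<XX>). \<forall>x\<in>carrier (K1 \<XX>).
          alpha (l' \<otimes>\<^bsub>grpL \<XX>\<^esub> actML \<XX> m' l) (m' \<otimes>\<^bsub>grpM \<XX>\<^esub> m) n x =
            alpha l' m' (bdy1 \<XX> m \<otimes>\<^bsub>grpN \<XX>\<^esub> n) x \<oplus>\<^bsub>K3 \<XX>\<^esub> alpha l m n x) \<and>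
      (\<forall>l\<in>carrier (grpL \<XX>). \<forall>l'\<in>carrier (grpL \<XX>). \<forall>m\<in>carrier (grpM \<XX>). \<forall>m'\<in>carrier (grpM \<XX>).
        \<forall>n\<in>carrier (grpN \<XX>). \<forall>n'\<in>carrier (grpN \<XX>). \<forall>x\<in>carrier (K1 \<XX>).
          alpha (l \<otimes>\<^bsub>grpL \<XX>\<^esub> actML \<XX> m (actL \<XX> n l')) (m \<otimes>\<^bsub>grpM \<XX>\<^esub> actM \<XX> n m') (n \<otimes>\<^bsub>grpN \<XX>\<^esub> n') x =
            lam2 (bdy1 \<XX> m' \<otimes>\<^bsub>grpN \<XX>\<^esub> n') (alpha l m n x) \<oplus>\<^bsub>K3 \<XX>\<^esub> alpha l' m' n' (lam0 n x)))"
proof -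
  interpret two_crossed_module \<XX> by (fact assms)
  show ?thesis
    by (rule conjI, rule is_complex_delta_bar, rule exI[of _ shift], rule exI[of _ lam1],
        rule exI[of _ lam2], rule exI[of _ lam'], rule exI[of _ lam''], rule exI[of _ alpha], intro conjI ballI)
      (simp_all only: lam_on_generators lam_functor chain_aut_lam one_homotopy_lam two_homotopy_lam
        lam_vertical lam_horizontal1 lam_horizontal2 alpha_vertical alpha_mult)
qed

end
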